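(* Let $\gamma$ be a closed convex planar curve with affine length $L$ and let $P_1\in\gamma$. For each $n$, let $P_2,P_3\in\gamma$ be such that $P_1,P_2,P_3$ are in positive orientation with $d(P_1,P_2)=d(P_2,P_3)=\frac Ln$, and let $\{P_1,\dots,P_m\}$ (with $m=m(n)$) be the points of $\gamma$ produced from $P_1,P_2,P_3$ by the trapezoidal algorithm (defined in the context). Denote by $\{\overline P_1=P_1,\overline P_2=P_2,\overline P_3=P_3,\overline P_4,\dots,\overline P_n\}$ the affinely uniform sample of $\gamma$, i.e. $d(\overline P_i,P_1)=(i-1)\frac Ln$. Then $$\lim_{n\to\infty}\frac mn=1,$$ and, for any $i$ (possibly depending on $n$) with $1\le i\le\min(m,n)$, $$\lim_{n\to\infty}d(P_i,\overline P_i)=0.$$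
   Context: $\gamma$ is a smooth closed convex planar curve, positively oriented, whose parameterizations satisfy $[\gamma'(t),\gamma''(t)]\neq0$, where $[\cdot,\cdot]$ is the determinant. The affine arc-length of an arc of $\gamma$ is $\int[\gamma'(t),\gamma''(t)]^{1/3}dt$; $L$ is the affine length (affine perimeter) of the whole curve, and $d(\cdot,\cdot)$ denotes affine distance (affine arc-length) along $\gamma$; in the definition of $\overline P_i$ it is measured from $P_1$ in the positive direction. Trapezoidal algorithm: given $P_1,P_2,P_3$, the point $P_4$ is the (other) intersection with $\gamma$ of the line through $P_1$ parallel to $P_2P_3$; in general, $P_{k+1}$ is the (other) intersection with $\gamma$ of the line through $P_{k-2}$ parallel to $P_{k-1}P_k$. The procedure is continued until the following stopping condition holds; $m$ is the first index $k\ge4$ for which it holds. Stopping condition for $P_1,\dots,P_k$: let $r_1$ be the line through $P_k$ and $P_1$, $r_2$ the line through $P_{k-2}$ parallel to $P_{k-1}P_k$, $r_3$ the line through $P_3$ parallel to $P_1P_2$, and $O=r_1\cap r_2$, $A=r_1\cap r_3$, $B=r_2\cap r_3$; the condition is that $r_2,r_3$ are not parallel, that $A$ lies between $P_3$ and $B$ on $r_3$ (i.e. $B$ lies on the half-line from $P_3$ through $A$, beyond $A$), and that $\mathrm{Area}(AOB)/\mathrm{Area}(P_1P_2P_3)<4$. *)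

theory Defs
  imports "HOL-Analysis.Analysis"
begin

definition bracket :: "real^2 \<Rightarrow> real^2 \<Rightarrow> real" where
  "bracket u v = det (vector [u, v] :: real^2^2)"

definition vderiv :: "(real \<Rightarrow> real^2) \<Rightarrow> real \<Rightarrow> real^2" where
  "vderiv f = (\<lambda>t. vector_derivative f (at t))"

definition smooth_curve :: "(real \<Rightarrow> real^2) \<Rightarrow> bool" where
  "smooth_curve \<gamma> \<longleftrightarrow> (\<forall>k. (vderiv ^^ k) \<gamma> differentiable_on UNIV)"

text \<open>
  A closed curve is given by a periodic parameterization of the whole real line with an arbitrary
  period \<open>T\<close>, traversed once on \<open>[0, T)\<close>.  Convex means that the trace is the boundary of a convex
  region, necessarily its own convex hull; positively oriented means that the interior of this
  region lies to the left of the velocity vector.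
\<close>
definition smooth_closed_convex_curve :: "(real \<Rightarrow> real^2) \<Rightarrow> real \<Rightarrow> bool" where
  "smooth_closed_convex_curve \<gamma> T \<longleftrightarrow>
     0 < T \<and> (\<forall>t. \<gamma> (t + T) = \<gamma> t) \<and> inj_on \<gamma> {0..<T} \<and>
     smooth_curve \<gamma> \<and>
     (\<forall>t. bracket (vderiv \<gamma> t) (vderiv (vderiv \<gamma>) t) \<noteq> 0) \<and>
     range \<gamma> = frontier (convex hull (range \<gamma>)) \<and>
     (\<forall>t. \<forall>x \<in> interior (convex hull (range \<gamma>)). 0 < bracket (vderiv \<gamma> t) (x - \<gamma> t))"

definition affine_arclength :: "(real \<Rightarrow> real^2) \<Rightarrow> real \<Rightarrow> real \<Rightarrow> real" where
  "affine_arclength \<gamma> a b =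
     integral {a..b} (\<lambda>t. root 3 (bracket (vderiv \<gamma> t) (vderiv (vderiv \<gamma>) t)))"

text \<open>
  Affine length of the arc from \<open>p\<close> to \<open>q\<close> in the positive direction.  Since \<open>\<gamma>\<close> is periodic, the
  infimum selects the arc that does not make additional full turns.
\<close>
definition pos_affine_dist :: "(real \<Rightarrow> real^2) \<Rightarrow> real^2 \<Rightarrow> real^2 \<Rightarrow> real" where
  "pos_affine_dist \<gamma> p q =
     Inf {affine_arclength \<gamma> a b | a b. a \<le> b \<and> \<gamma> a = p \<and> \<gamma> b = q}"

text \<open>Affine distance along the curve: the shorter of the two arcs joining the points.\<close>
definition affine_dist :: "(real \<Rightarrow> real^2) \<Rightarrow> real^2 \<Rightarrow> real^2 \<Rightarrow> real" where
  "affine_dist \<gamma> p q = min (pos_affine_dist \<gamma> p q) (pos_affine_dist \<gamma> q p)"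

text \<open>The line through \<open>a\<close> parallel to the line \<open>bc\<close>.\<close>
definition parallel_line :: "real^2 \<Rightarrow> real^2 \<Rightarrow> real^2 \<Rightarrow> (real^2) set" where
  "parallel_line a b c = range (\<lambda>s. a + s *\<^sub>R (c - b))"

definition other_intersection :: "(real^2) set \<Rightarrow> real^2 \<Rightarrow> real^2 \<Rightarrow> real^2 \<Rightarrow> real^2" where
  "other_intersection C a b c = (THE x. x \<noteq> a \<and> C \<inter> parallel_line a b c = {a, x})"

text \<open>Points are numbered from 1; the value at index 0 is irrelevant.\<close>
fun trapezoidal ::
  "(real^2) set \<Rightarrow> real^2 \<Rightarrow> real^2 \<Rightarrow> real^2 \<Rightarrow> nat \<Rightarrow> real^2" where
  "trapezoidal C p1 p2 p3 0 = p1"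
| "trapezoidal C p1 p2 p3 (Suc 0) = p1"
| "trapezoidal C p1 p2 p3 (Suc (Suc 0)) = p2"
| "trapezoidal C p1 p2 p3 (Suc (Suc (Suc 0))) = p3"
| "trapezoidal C p1 p2 p3 (Suc (Suc (Suc (Suc k)))) =
     other_intersection C
       (trapezoidal C p1 p2 p3 (Suc k))
       (trapezoidal C p1 p2 p3 (Suc (Suc k)))
       (trapezoidal C p1 p2 p3 (Suc (Suc (Suc k))))"

definition triangle_area :: "real^2 \<Rightarrow> real^2 \<Rightarrow> real^2 \<Rightarrow> real" where
  "triangle_area a b c = measure lebesgue (convex hull {a, b, c})"

definition stopping_condition :: "(nat \<Rightarrow> real^2) \<Rightarrow> nat \<Rightarrow> bool" where
  "stopping_condition P k \<longleftrightarrow>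
     (let r1 = affine hull {P k, P 1};
          r2 = parallel_line (P (k - 2)) (P (k - 1)) (P k);
          r3 = parallel_line (P 3) (P 1) (P 2)
      in \<not> affine_parallel r2 r3 \<and>
         (\<exists>a b q. r1 \<inter> r2 = {q} \<and> r1 \<inter> r3 = {a} \<and> r2 \<inter> r3 = {b} \<and>
            a \<in> open_segment (P 3) b \<and>
            triangle_area a q b / triangle_area (P 1) (P 2) (P 3) < 4))"

text \<open>
  If the procedure never stops, this is the least element of the empty set, a fixed number that
  does not depend on \<open>P\<close>.  Hence a limit 1 of \<open>stopping_index (P n) / n\<close> entails that the procedure
  stops for all large \<open>n\<close>.
\<close>
definition stopping_index :: "(nat \<Rightarrow> real^2) \<Rightarrow> nat" where
  "stopping_index P = (LEAST k. 4 \<le> k \<and> stopping_condition P k)"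

end

(* In affine arc length the determinant of the chords from s to t and from s' to t' agrees, up to a
   third-order multiple of (t - s) (t' - s'), with its value (t - s) (t' - s') (s' + t' - s - t) / 2 on
   a parabola.
   Hence each gap produced by the trapezoidal algorithm equals the last gap but one up to O(h^3), where
   h = L/n, and after O(n) steps the points have drifted from the uniform sample by O(h) only.
   Far away from P_1 the triangle AOB has area bounded below, so the algorithm does not stop there.
   Close after P_1 the point B lies on the wrong side of A.
   When the points come back to P_1, the limiting configuration is that of points on a parabola: if
   P_1, P_2, P_3 have abscissae 0, h, 2h and P_k has abscissa zh, the stopping condition holds for
   z in [-2.8, -1.7], an interval longer than a gap. *)

theory Submission
  imports Defs
begin

section \<open>Determinants and the stopping condition\<close>

text \<open>In affine arc length [\<beta>', \<beta>''] = 1, hence [\<beta>', \<beta>'''] = 0, and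
  [\<beta>'(x), \<beta>'(y)] equals y - x without a quadratic term. This decides the matter: an
  error e in each step sums to n e in a gap and to n^2 e in a position, so e = O(h^3) gives a drift
  O(h), whereas an error of order h^2 would give no bound that tends to 0. After the start the
  distance of P_k from P_1 runs through all scales between h and 1, so that no single limit
  describes it; there signs of determinants replace limits. Before the return, stopping a little
  early is harmless: only positions farther than some \<eta> from P_1 have to be excluded, and
  \<eta> is arbitrary as far as the limit of m/n is concerned. Uniformity in k comes from
  compactness: a sequence of counterexamples has a subsequence along which the positions
  converge.\<close>

lemma bracket_eq: "bracket u v = u $ 1 * v $ 2 - u $ 2 * v $ 1"
  by (simp add: bracket_def det_2)

lemma bounded_bilinear_bracket: "bounded_bilinear bracket"
proof
  show "\<exists>K. \<forall>u v. norm (bracket u v) \<le> norm u * norm v * K"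
  proof (intro exI allI)
    fix u v :: "real^2"
    have "\<bar>u $ 1 * v $ 2\<bar> \<le> norm u * norm v" "\<bar>u $ 2 * v $ 1\<bar> \<le> norm u * norm v"
      unfolding abs_mult by (intro mult_mono component_le_norm_cart; simp)+
    then show "norm (bracket u v) \<le> norm u * norm v * 2"
      by (simp add: bracket_eq)
  qed
qed (simp_all add: bracket_eq algebra_simps)

interpretation bracket: bounded_bilinear bracket
  by (rule bounded_bilinear_bracket)

declare bracket.zero_left [simp] bracket.zero_right [simp]

lemma bracket_self [simp]: "bracket u u = 0"
  by (simp add: bracket_eq)

lemma bracket_commute: "bracket u v = - bracket v u"
  by (simp add: bracket_eq)

lemma bracket_eq_0_imp_scaleR:
  assumes "bracket u v = 0" "v \<noteq> 0"
  obtains s where "u = s *\<^sub>R v"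
proof (cases "v $ 1 = 0")
  case True
  then have "v $ 2 \<noteq> 0" using assms(2) by (auto simp: vec_eq_iff forall_2)
  then have "u = (u $ 2 / v $ 2) *\<^sub>R v"
    using assms(1) True by (auto simp: vec_eq_iff forall_2 bracket_eq)
  then show ?thesis by (rule that)
next
  case False
  then have "u = (u $ 1 / v $ 1) *\<^sub>R v"
    using assms(1) by (auto simp: vec_eq_iff forall_2 bracket_eq field_simps)
  then show ?thesis by (rule that)
qed

text \<open>Cramer's rule in the basis formed by \<open>u\<close> and \<open>v\<close>.\<close>

lemma bracket_nondegenerate:
  assumes "bracket u v \<noteq> 0"
  shows "x = (bracket x v / bracket u v) *\<^sub>R u + (bracket u x / bracket u v) *\<^sub>R v"
proof -
  have "bracket u v *\<^sub>R x = bracket x v *\<^sub>R u + bracket u x *\<^sub>R v"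
    by (simp add: vec_eq_iff forall_2 bracket_eq algebra_simps)
  then have "(1 / bracket u v) *\<^sub>R (bracket u v *\<^sub>R x)
      = (1 / bracket u v) *\<^sub>R (bracket x v *\<^sub>R u + bracket u x *\<^sub>R v)"
    by simp
  then show ?thesis using assms by (simp add: scaleR_add_right)
qed

lemma bracket_has_real_derivative_right:
  assumes "(f has_vector_derivative f') (at x within S)"
  shows "((\<lambda>x. bracket v (f x)) has_real_derivative bracket v f') (at x within S)"
  using bounded_linear.has_vector_derivative[OF bracket.bounded_linear_right assms]
  by (simp add: has_real_derivative_iff_has_vector_derivative)

lemma bracket_has_real_derivative_left:
  assumes "(f has_vector_derivative f') (at x within S)"
  shows "((\<lambda>x. bracket (f x) v) has_real_derivative bracket f' v) (at x within S)"
  using bounded_linear.has_vector_derivative[OF bracket.bounded_linear_left assms]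
  by (simp add: has_real_derivative_iff_has_vector_derivative)

lemma triangle_area_bracket: "triangle_area a b c = \<bar>bracket (b - a) (c - a)\<bar> / 2"
proof -
  have "convex hull {a, b, c} \<in> sets lborel"
    by (simp add: borel_compact finite_imp_compact_convex_hull)
  then have "triangle_area a b c = measure lborel (convex hull {a, b, c})"
    by (simp add: triangle_area_def measure_completion)
  then show ?thesis
    by (simp add: content_triangle bracket_eq algebra_simps abs_minus_commute)
qed

text \<open>The endpoints may come in either order or coincide, so that chords can later be taken in
  either direction without a case distinction.\<close>

lemma mvt_closed_segment:
  fixes f f' :: "real \<Rightarrow> real"
  assumes "\<And>x. (f has_real_derivative f' x) (at x)"
  obtains \<xi> where "\<xi> \<in> closed_segment a b" "f b - f a = (b - a) * f' \<xi>"
proof (cases a b rule: linorder_cases)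
  case less
  obtain \<xi> where "a < \<xi>" "\<xi> < b" "f b - f a = (b - a) * f' \<xi>"
    using MVT2[OF less] assms by blast
  then show ?thesis using that[of \<xi>] by (simp add: closed_segment_eq_real_ivl)
next
  case equal
  then show ?thesis using that[of a] by simp
next
  case greater
  obtain \<xi> where "b < \<xi>" "\<xi> < a" "f a - f b = (a - b) * f' \<xi>"
    using MVT2[OF greater] assms by blast
  then show ?thesis using that[of \<xi>] by (simp add: closed_segment_eq_real_ivl algebra_simps)
qed

section \<open>Lines described by determinants, and the stopping condition in coordinates\<close>

lemma mem_parallel_line_iff:
  assumes "b \<noteq> c"
  shows "x \<in> parallel_line a b c \<longleftrightarrow> bracket (c - b) (x - a) = 0"
proof
  assume "x \<in> parallel_line a b c"
  then show "bracket (c - b) (x - a) = 0"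
    by (auto simp: parallel_line_def bracket.scaleR_right)
next
  assume "bracket (c - b) (x - a) = 0"
  then have "bracket (x - a) (c - b) = 0" by (subst bracket_commute) simp
  then obtain s where "x - a = s *\<^sub>R (c - b)"
    using bracket_eq_0_imp_scaleR assms by (metis eq_iff_diff_eq_0)
  then have "x = a + s *\<^sub>R (c - b)" by (simp add: algebra_simps)
  then show "x \<in> parallel_line a b c" by (auto simp: parallel_line_def)
qed

lemma mem_affine_hull_2_iff:
  fixes a b x :: "real^2"
  assumes "a \<noteq> b"
  shows "x \<in> affine hull {a, b} \<longleftrightarrow> bracket (a - b) (x - b) = 0"
proof -
  have "affine hull {a, b} = parallel_line b b a"
  proof (intro equalityI subsetI)
    fix y assume "y \<in> affine hull {a, b}"
    then obtain s t where "y = s *\<^sub>R a + t *\<^sub>R b" "s + t = 1"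
      by (auto simp: affine_hull_2)
    then have "y = b + s *\<^sub>R (a - b)" by (simp add: algebra_simps flip: scaleR_add_left)
    then show "y \<in> parallel_line b b a" by (auto simp: parallel_line_def)
  next
    fix y assume "y \<in> parallel_line b b a"
    then obtain s where "y = b + s *\<^sub>R (a - b)" by (auto simp: parallel_line_def)
    then have "y = s *\<^sub>R a + (1 - s) *\<^sub>R b" by (simp add: algebra_simps)
    then show "y \<in> affine hull {a, b}" unfolding affine_hull_2 by force
  qed
  then show ?thesis using assms by (simp add: mem_parallel_line_iff)
qed

text \<open>On \<open>r3\<close>, with origin \<open>P 3\<close> and unit \<open>u\<close>, the
  points A and B have the coordinates \<open>\<theta> * s\<close> and \<open>s\<close>. The
  coordinate of B is unbounded when \<open>r2\<close> becomes parallel to \<open>r3\<close>.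
  Therefore B is eliminated from the area inequality and the denominators are multiplied out; what
  remains involves A only and passes to the limit.\<close>

lemma stopping_conditionD:
  fixes P :: "nat \<Rightarrow> real^2" and k :: nat
  defines "u \<equiv> P 2 - P 1" and "w \<equiv> P k - P (k - 1)" and "d \<equiv> P k - P 1"
  assumes stop: "stopping_condition P k"
    and nz: "bracket u d \<noteq> 0" "bracket u (P 3 - P 1) \<noteq> 0" "w \<noteq> 0"
  obtains s \<theta> where "0 < \<theta>" "\<theta> < 1"
    "\<theta> * s * bracket u d = bracket (P 1 - P 3) d"
    "s * bracket u w = bracket (P (k - 2) - P 3) w"
    "(bracket (P 3 + (\<theta> * s) *\<^sub>R u - P (k - 2)) w)\<^sup>2 * \<bar>bracket u d\<bar>
       \<le> 4 * \<bar>bracket u (P 3 - P 1)\<bar> * \<bar>bracket w d\<bar> * \<bar>bracket u w\<bar>"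
proof -
  have "u \<noteq> 0" "d \<noteq> 0" using nz by auto
  then have ne: "P 1 \<noteq> P 2" "P k \<noteq> P 1" "P (k - 1) \<noteq> P k"
    using nz by (auto simp: u_def d_def w_def)
  obtain a b q where
      1: "affine hull {P k, P 1} \<inter> parallel_line (P (k - 2)) (P (k - 1)) (P k) = {q}"
    and 2: "affine hull {P k, P 1} \<inter> parallel_line (P 3) (P 1) (P 2) = {a}"
    and 3: "parallel_line (P (k - 2)) (P (k - 1)) (P k) \<inter> parallel_line (P 3) (P 1) (P 2) = {b}"
    and seg: "a \<in> open_segment (P 3) b"
    and area: "triangle_area a q b / triangle_area (P 1) (P 2) (P 3) < 4"
    using stop unfolding stopping_condition_def Let_def by auto
  have q: "bracket d (q - P 1) = 0" "bracket w (q - P (k - 2)) = 0"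
    using 1 ne by (auto simp: mem_affine_hull_2_iff mem_parallel_line_iff d_def w_def)
  have a: "bracket d (a - P 1) = 0"
    using 2 ne by (auto simp: mem_affine_hull_2_iff d_def)
  have b: "bracket w (b - P (k - 2)) = 0"
    using 3 ne by (auto simp: mem_parallel_line_iff w_def)
  obtain s where s: "b = P 3 + s *\<^sub>R u"
    using 3 by (auto simp: parallel_line_def u_def)
  obtain \<theta> where \<theta>: "0 < \<theta>" "\<theta> < 1" "a = (1 - \<theta>) *\<^sub>R P 3 + \<theta> *\<^sub>R b"
    using seg by (auto simp: in_segment)
  have a_eq: "a = P 3 + (\<theta> * s) *\<^sub>R u" using \<theta>(3) s by (simp add: algebra_simps)
  have e1: "\<theta> * s * bracket u d = bracket (P 1 - P 3) d"
    using a unfolding a_eq by (simp add: bracket_eq algebra_simps)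
  have e2: "s * bracket u w = bracket (P (k - 2) - P 3) w"
    using b unfolding s by (simp add: bracket_eq algebra_simps)
  have "bracket (q - b) w = 0" using q b by (simp add: bracket_eq algebra_simps)
  then obtain t where t: "q - b = t *\<^sub>R w" using bracket_eq_0_imp_scaleR nz(3) by blast
  \<comment> \<open>The coordinate of A minus that of B. Since O = B + t w lies on \<open>r1\<close>
    together with A, \<open>t\<close> and \<open>\<alpha>\<close> determine each other.\<close>
  define \<alpha> where "\<alpha> = \<theta> * s - s"
  have ab: "a - b = \<alpha> *\<^sub>R u" by (simp add: a_eq s \<alpha>_def algebra_simps)
  have qa: "q - a = t *\<^sub>R w - \<alpha> *\<^sub>R u" and ba: "b - a = - (\<alpha> *\<^sub>R u)"
    by (simp_all flip: t ab)
  have "bracket d (q - a) = 0" using q a by (simp add: bracket_eq algebra_simps)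
  then have t2: "t * bracket w d = \<alpha> * bracket u d"
    unfolding qa by (simp add: bracket_eq algebra_simps)
  have "triangle_area (P 1) (P 2) (P 3) > 0"
    using nz by (simp add: triangle_area_bracket u_def)
  then have "triangle_area a q b \<le> 4 * triangle_area (P 1) (P 2) (P 3)"
    using area by (simp add: field_simps)
  moreover have "bracket (q - a) (b - a) = t * \<alpha> * bracket u w"
    unfolding qa ba by (simp add: bracket_eq algebra_simps)
  ultimately have "\<bar>t * \<alpha> * bracket u w\<bar> \<le> 4 * \<bar>bracket u (P 3 - P 1)\<bar>"
    by (simp add: triangle_area_bracket u_def)
  \<comment> \<open>The factor [w, d] turns \<open>t\<close> into \<open>\<alpha>\<close>, and
    [u, w] turns \<open>\<alpha>\<close> into a determinant with A. Either factor may vanish, hence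
    the weak inequality.\<close>
  then have "\<bar>t * \<alpha> * bracket u w\<bar> * (\<bar>bracket w d\<bar> * \<bar>bracket u w\<bar>)
      \<le> 4 * \<bar>bracket u (P 3 - P 1)\<bar> * (\<bar>bracket w d\<bar> * \<bar>bracket u w\<bar>)"
    by (rule mult_right_mono) simp
  moreover have "\<bar>t * \<alpha> * bracket u w\<bar> * (\<bar>bracket w d\<bar> * \<bar>bracket u w\<bar>)
      = \<bar>(t * bracket w d) * \<alpha> * (bracket u w)\<^sup>2\<bar>"
    by (simp add: abs_mult power2_eq_square)
  moreover have "\<dots> = (\<alpha> * bracket u w)\<^sup>2 * \<bar>bracket u d\<bar>"
    unfolding t2 by (simp add: abs_mult power2_eq_square algebra_simps)
  moreover have "\<alpha> * bracket u w = bracket (a - P (k - 2)) w"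
  proof -
    have "bracket (a - b) w + bracket (b - P (k - 2)) w = bracket (a - P (k - 2)) w"
      by (simp flip: bracket.add_left)
    then show ?thesis
      using b by (simp add: ab bracket.scaleR_left bracket_commute[of "b - P (k - 2)" w])
  qed
  ultimately show ?thesis
    using that[of \<theta> s] \<theta> e1 e2 by (simp add: a_eq mult.assoc)
qed

text \<open>\<open>s\<close> and \<open>t\<close> are the coordinates of A and B on
  \<open>r3\<close>, so \<open>t < s < 0\<close> places B beyond A. The triangle AOB has the base (s
  - t) u and sides along \<open>d\<close> and \<open>w\<close>; the left-hand side of
  \<open>area\<close> is twice its area. The three nonzero determinants say that no two of the lines
  are parallel.\<close>

lemma stopping_conditionI:
  fixes P :: "nat \<Rightarrow> real^2" and k :: nat
  defines "u \<equiv> P 2 - P 1" and "w \<equiv> P k - P (k - 1)" and "d \<equiv> P k - P 1"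
  defines "s \<equiv> bracket (P 1 - P 3) d / bracket u d"
    and "t \<equiv> bracket (P (k - 2) - P 3) w / bracket u w"
  assumes nz: "bracket u d \<noteq> 0" "bracket w d \<noteq> 0" "bracket u w \<noteq> 0"
    and ord: "t < s" "s < 0"
    and area: "(s - t)\<^sup>2 * \<bar>bracket u d\<bar> * \<bar>bracket u w\<bar> / \<bar>bracket w d\<bar> < 4 * \<bar>bracket u (P 3 - P 1)\<bar>"
  shows "stopping_condition P k"
proof -
  have "u \<noteq> 0" "d \<noteq> 0" "w \<noteq> 0" using nz by auto
  then have ne: "P 1 \<noteq> P 2" "P k \<noteq> P 1" "P (k - 1) \<noteq> P k"
    using nz by (auto simp: u_def d_def w_def)
  define r1 r2 r3 where "r1 = affine hull {P k, P 1}"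
    and "r2 = parallel_line (P (k - 2)) (P (k - 1)) (P k)"
    and "r3 = parallel_line (P 3) (P 1) (P 2)"
  have r1: "x \<in> r1 \<longleftrightarrow> bracket d (x - P 1) = 0" for x
    using ne by (simp add: r1_def mem_affine_hull_2_iff d_def)
  have r2: "x \<in> r2 \<longleftrightarrow> bracket w (x - P (k - 2)) = 0" for x
    using ne by (simp add: r2_def mem_parallel_line_iff w_def)
  have r3: "x \<in> r3 \<longleftrightarrow> bracket u (x - P 3) = 0" for x
    using ne by (simp add: r3_def mem_parallel_line_iff u_def)
  have single: "{x. bracket v1 (x - x1) = 0} \<inter> {x. bracket v2 (x - x2) = 0} = {x}"
    if "bracket v1 v2 \<noteq> 0" "bracket v1 (x - x1) = 0" "bracket v2 (x - x2) = 0"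
    for v1 v2 x1 x2 x :: "real^2"
  proof -
    have "y = x" if y: "bracket v1 (y - x1) = 0" "bracket v2 (y - x2) = 0" for y
    proof -
      have "bracket v1 (y - x) = 0" "bracket v2 (y - x) = 0"
        using y \<open>bracket v1 (x - x1) = 0\<close> \<open>bracket v2 (x - x2) = 0\<close>
        by (simp_all add: bracket.diff_right)
      then have "bracket (y - x) v2 = 0" "bracket v1 (y - x) = 0"
        by (simp_all add: bracket_commute[of "y - x" v2])
      then have "y - x = 0"
        using bracket_nondegenerate[OF \<open>bracket v1 v2 \<noteq> 0\<close>, of "y - x"] by simp
      then show ?thesis by simp
    qed
    then show ?thesis using that(2,3) by blast
  qed
  \<comment> \<open>The point O is reached from B along \<open>r2\<close>; the coefficient of
    \<open>w\<close> is the solution of [d, q - a] = 0, which puts it on \<open>r1\<close>.\<close>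
  define a b q where "a = P 3 + s *\<^sub>R u" and "b = P 3 + t *\<^sub>R u"
    and "q = b + ((s - t) * bracket u d / bracket w d) *\<^sub>R w"
  have sd: "s * bracket u d = bracket (P 1 - P 3) d" using nz by (simp add: s_def)
  have tw: "t * bracket u w = bracket (P (k - 2) - P 3) w" using nz by (simp add: t_def)
  have a1: "bracket d (a - P 1) = 0"
    using sd by (simp add: a_def bracket_eq algebra_simps)
  have b2: "bracket w (b - P (k - 2)) = 0"
    using tw by (simp add: b_def bracket_eq algebra_simps)
  have q2: "bracket w (q - P (k - 2)) = 0"
    using b2 by (simp add: q_def bracket_eq algebra_simps)
  have "bracket d (q - P 1) = bracket d (a - P 1) + bracket d (q - a)"
    by (simp flip: bracket.add_right)
  also have "q - a = ((s - t) * bracket u d / bracket w d) *\<^sub>R w - (s - t) *\<^sub>R u"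
    by (simp add: q_def a_def b_def algebra_simps)
  also have "bracket d (\<dots>) = ((s - t) * bracket u d / bracket w d) * bracket d w - (s - t) * bracket d u"
    by (simp add: bracket.diff_right bracket.scaleR_right)
  also have "\<dots> = 0"
    using nz by (simp add: bracket_commute[of d w] bracket_commute[of d u])
  finally have q1: "bracket d (q - P 1) = 0" using a1 by simp
  have 1: "r1 \<inter> r2 = {q}"
    using single[of d w q "P 1" "P (k - 2)"] q1 q2 nz r1 r2 by (auto simp: bracket_commute[of d w])
  have 2: "r1 \<inter> r3 = {a}"
    using single[of d u a "P 1" "P 3"] a1 nz r1 r3
    by (auto simp: bracket_commute[of d u] a_def bracket.scaleR_right)
  have 3: "r2 \<inter> r3 = {b}"
    using single[of w u b "P (k - 2)" "P 3"] b2 nz r2 r3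
    by (auto simp: bracket_commute[of w u] b_def bracket.scaleR_right)
  \<comment> \<open>A translation of \<open>r2\<close> onto \<open>r3\<close> would carry two points
    with difference \<open>w\<close> to \<open>r3\<close> and force [u, w] = 0.\<close>
  have par: "\<not> affine_parallel r2 r3"
  proof
    assume "affine_parallel r2 r3"
    then obtain e where e: "r3 = (\<lambda>x. e + x) ` r2" by (auto simp: affine_parallel_def)
    have "P (k - 2) \<in> r2" "P (k - 2) + w \<in> r2" by (simp_all add: r2)
    then have "e + P (k - 2) \<in> r3" "e + (P (k - 2) + w) \<in> r3" using e by blast+
    then have "bracket u w = 0" unfolding r3 by (simp add: bracket_eq algebra_simps)
    then show False using nz by simp
  qed
  have seg: "a \<in> open_segment (P 3) b"
  proof -
    have "P 3 \<noteq> b" using ord \<open>u \<noteq> 0\<close> by (simp add: b_def)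
    moreover have "a = (1 - s / t) *\<^sub>R P 3 + (s / t) *\<^sub>R b"
      using ord by (simp add: a_def b_def algebra_simps)
    moreover have "0 < s / t" "s / t < 1" using ord by (auto simp: field_simps)
    ultimately show ?thesis by (auto simp: in_segment)
  qed
  have "q - a = ((s - t) * bracket u d / bracket w d) *\<^sub>R w - (s - t) *\<^sub>R u" "b - a = - ((s - t) *\<^sub>R u)"
    by (simp_all add: q_def a_def b_def algebra_simps)
  then have "bracket (q - a) (b - a) = ((s - t) * bracket u d / bracket w d) * (s - t) * bracket u w"
    by (simp add: bracket.diff_left bracket.diff_right bracket.minus_right bracket.scaleR_left bracket.scaleR_right
        bracket_commute[of w u])
  moreover define X where "X = (s - t)\<^sup>2 * \<bar>bracket u d\<bar> * \<bar>bracket u w\<bar> / \<bar>bracket w d\<bar>"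
  ultimately have "triangle_area a q b = X / 2"
    by (simp add: triangle_area_bracket abs_mult power2_eq_square)
  moreover have "X < 4 * \<bar>bracket u (P 3 - P 1)\<bar>" using area by (simp only: X_def)
  ultimately have "triangle_area a q b < 2 * \<bar>bracket u (P 3 - P 1)\<bar>" by linarith
  moreover have "triangle_area (P 1) (P 2) (P 3) = \<bar>bracket u (P 3 - P 1)\<bar> / 2"
    by (simp add: triangle_area_bracket u_def)
  moreover have "0 \<le> triangle_area a q b" by (simp add: triangle_area_bracket)
  ultimately have "triangle_area a q b / triangle_area (P 1) (P 2) (P 3) < 4"
    by (simp add: divide_less_eq)
  with 1 2 3 par seg show ?thesis
    unfolding stopping_condition_def Let_def r1_def r2_def r3_def by blast
qed

section \<open>Convex curves in affine arc length\<close>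

text \<open>The properties of a closed convex curve in affine arc length on which the asymptotics
  rest, stated with the first derivative only. \<open>approx\<close> is the consequence of
  [\<beta>', \<beta>''] = 1, and \<open>support\<close> is strict convexity: apart from the point of
  contact the curve lies strictly to the left of each tangent.\<close>

locale affine_curve =
  fixes \<beta> \<beta>' :: "real \<Rightarrow> real^2" and L C :: real
  assumes L_pos: "0 < L"
    and periodic: "\<beta> (x + L) = \<beta> x"
    and injective: "\<beta> x = \<beta> y \<Longrightarrow> \<exists>j::int. y = x + of_int j * L"
    and deriv: "(\<beta> has_vector_derivative \<beta>' x) (at x)"
    and cont: "continuous_on UNIV \<beta>'"
    and approx: "\<bar>bracket (\<beta>' x) (\<beta>' y) - (y - x)\<bar> \<le> C * \<bar>y - x\<bar> ^ 3"
    and support: "\<beta> x \<noteq> \<beta> y \<Longrightarrow> 0 < bracket (\<beta>' x) (\<beta> y - \<beta> x)"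
begin

lemma C_nonneg: "0 \<le> C"
  using approx[of 0 1] by simp

lemma injective_near: "\<beta> x = \<beta> y \<Longrightarrow> \<bar>y - x\<bar> < L \<Longrightarrow> y = x"
proof -
  assume "\<beta> x = \<beta> y" and lt: "\<bar>y - x\<bar> < L"
  then obtain j :: int where j: "y = x + of_int j * L" using injective by blast
  then have "\<bar>of_int j\<bar> * L < 1 * L" using lt L_pos by (simp add: abs_mult)
  then have "\<bar>j\<bar> < 1" using L_pos by (simp del: mult_1 flip: of_int_abs)
  then show "y = x" using j by simp
qed

section \<open>Comparison of chord determinants with those of a parabola\<close>

text \<open>The determinant of two chords is the integral of [\<beta>'(x), \<beta>'(y)] over the
  rectangle between their parameters, and y - x integrates to (b - a) (d - c) (c + d - a - b) / 2.
  The mean value theorem, applied to the difference in one variable after the other, takes the place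
  of the double integral.\<close>

lemma chords_mvt:
  obtains \<xi> \<eta> where "\<xi> \<in> closed_segment a b" "\<eta> \<in> closed_segment c d"
    "bracket (\<beta> b - \<beta> a) (\<beta> d - \<beta> c) - (b - a) * (d - c) * (c + d - a - b) / 2
      = (b - a) * (d - c) * (bracket (\<beta>' \<xi>) (\<beta>' \<eta>) - (\<eta> - \<xi>))"
proof -
  have 1: "((\<lambda>x. bracket (\<beta> x) (\<beta> d - \<beta> c) - ((d\<^sup>2 - c\<^sup>2) / 2 * x - (d - c) * x\<^sup>2 / 2))
      has_real_derivative bracket (\<beta>' x) (\<beta> d - \<beta> c) - ((d\<^sup>2 - c\<^sup>2) / 2 - (d - c) * x)) (at x)" for x
    by (auto intro!: derivative_eq_intros bracket_has_real_derivative_left deriv)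
  obtain \<xi> where \<xi>: "\<xi> \<in> closed_segment a b"
    "(bracket (\<beta> b) (\<beta> d - \<beta> c) - ((d\<^sup>2 - c\<^sup>2) / 2 * b - (d - c) * b\<^sup>2 / 2))
     - (bracket (\<beta> a) (\<beta> d - \<beta> c) - ((d\<^sup>2 - c\<^sup>2) / 2 * a - (d - c) * a\<^sup>2 / 2))
     = (b - a) * (bracket (\<beta>' \<xi>) (\<beta> d - \<beta> c) - ((d\<^sup>2 - c\<^sup>2) / 2 - (d - c) * \<xi>))"
    by (rule mvt_closed_segment[OF 1])
  have 2: "((\<lambda>y. bracket (\<beta>' \<xi>) (\<beta> y) - (y\<^sup>2 / 2 - \<xi> * y))
      has_real_derivative bracket (\<beta>' \<xi>) (\<beta>' y) - (y - \<xi>)) (at y)" for y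
    by (auto intro!: derivative_eq_intros bracket_has_real_derivative_right deriv)
  obtain \<eta> where \<eta>: "\<eta> \<in> closed_segment c d"
    "(bracket (\<beta>' \<xi>) (\<beta> d) - (d\<^sup>2 / 2 - \<xi> * d)) - (bracket (\<beta>' \<xi>) (\<beta> c) - (c\<^sup>2 / 2 - \<xi> * c))
     = (d - c) * (bracket (\<beta>' \<xi>) (\<beta>' \<eta>) - (\<eta> - \<xi>))"
    by (rule mvt_closed_segment[OF 2])
  have "bracket (\<beta>' \<xi>) (\<beta> d - \<beta> c) - ((d\<^sup>2 - c\<^sup>2) / 2 - (d - c) * \<xi>)
      = (d - c) * (bracket (\<beta>' \<xi>) (\<beta>' \<eta>) - (\<eta> - \<xi>))"
    using \<eta>(2) by (simp add: bracket.diff_right field_simps)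
  with \<xi>(2) have "(bracket (\<beta> b) (\<beta> d - \<beta> c) - ((d\<^sup>2 - c\<^sup>2) / 2 * b - (d - c) * b\<^sup>2 / 2))
     - (bracket (\<beta> a) (\<beta> d - \<beta> c) - ((d\<^sup>2 - c\<^sup>2) / 2 * a - (d - c) * a\<^sup>2 / 2))
     = (b - a) * ((d - c) * (bracket (\<beta>' \<xi>) (\<beta>' \<eta>) - (\<eta> - \<xi>)))" by simp
  moreover have "bracket (\<beta> b - \<beta> a) (\<beta> d - \<beta> c) - (b - a) * (d - c) * (c + d - a - b) / 2
     = (bracket (\<beta> b) (\<beta> d - \<beta> c) - ((d\<^sup>2 - c\<^sup>2) / 2 * b - (d - c) * b\<^sup>2 / 2))
     - (bracket (\<beta> a) (\<beta> d - \<beta> c) - ((d\<^sup>2 - c\<^sup>2) / 2 * a - (d - c) * a\<^sup>2 / 2))"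
    by (simp add: bracket.diff_left field_simps power2_eq_square)
  ultimately show ?thesis using that \<xi>(1) \<eta>(1) by (simp add: mult.assoc)
qed

text \<open>The bound keeps the lengths of both chords as factors, so that they can be cancelled
  where the determinant is set to zero.\<close>

lemma bracket_chords_error:
  assumes "{a, b, c, d} \<subseteq> {x..x + l}"
  shows "\<bar>bracket (\<beta> b - \<beta> a) (\<beta> d - \<beta> c) - (b - a) * (d - c) * (c + d - a - b) / 2\<bar>
    \<le> \<bar>b - a\<bar> * \<bar>d - c\<bar> * (C * l ^ 3)"
proof -
  obtain \<xi> \<eta> where *: "\<xi> \<in> closed_segment a b" "\<eta> \<in> closed_segment c d"
    "bracket (\<beta> b - \<beta> a) (\<beta> d - \<beta> c) - (b - a) * (d - c) * (c + d - a - b) / 2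
      = (b - a) * (d - c) * (bracket (\<beta>' \<xi>) (\<beta>' \<eta>) - (\<eta> - \<xi>))"
    by (rule chords_mvt)
  have "\<xi> \<in> {x..x + l}" "\<eta> \<in> {x..x + l}"
    using * assms by (auto simp: closed_segment_eq_real_ivl split: if_splits)
  then have "\<bar>\<eta> - \<xi>\<bar> ^ 3 \<le> l ^ 3" by (intro power_mono) auto
  then have "\<bar>bracket (\<beta>' \<xi>) (\<beta>' \<eta>) - (\<eta> - \<xi>)\<bar> \<le> C * l ^ 3"
    using approx[of \<xi> \<eta>] C_nonneg by (meson mult_left_mono order_trans)
  then show ?thesis
    unfolding *(3) abs_mult by (intro mult_left_mono) auto
qed

text \<open>Blow-up at \<open>x\<close>: in parameters scaled by \<open>h n\<close> the determinants
  become those of a parabola, and h^3 is their common order.\<close>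

lemma bracket_chords_tendsto:
  assumes h: "h \<longlonglongrightarrow> 0" "\<And>n. 0 < h n"
    and a: "a \<longlonglongrightarrow> a0" and b: "b \<longlonglongrightarrow> b0" and c: "c \<longlonglongrightarrow> c0" and d: "d \<longlonglongrightarrow> d0"
  shows "(\<lambda>n. bracket (\<beta> (x + h n * b n) - \<beta> (x + h n * a n)) (\<beta> (x + h n * d n) - \<beta> (x + h n * c n)) / h n ^ 3)
    \<longlonglongrightarrow> (b0 - a0) * (d0 - c0) * (c0 + d0 - a0 - b0) / 2"
proof -
  define M where "M n = \<bar>a n\<bar> + \<bar>b n\<bar> + \<bar>c n\<bar> + \<bar>d n\<bar>" for n
  define B where "B n = bracket (\<beta> (x + h n * b n) - \<beta> (x + h n * a n)) (\<beta> (x + h n * d n) - \<beta> (x + h n * c n))" for n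
  define V where "V n = (b n - a n) * (d n - c n) * (c n + d n - a n - b n) / 2" for n
  define E where "E n = \<bar>b n - a n\<bar> * \<bar>d n - c n\<bar> * (C * (2 * M n) ^ 3 * (h n)\<^sup>2)" for n
  have "M \<longlonglongrightarrow> \<bar>a0\<bar> + \<bar>b0\<bar> + \<bar>c0\<bar> + \<bar>d0\<bar>"
    unfolding M_def by (intro tendsto_intros assms)
  then have "E \<longlonglongrightarrow> \<bar>b0 - a0\<bar> * \<bar>d0 - c0\<bar> * (C * (2 * (\<bar>a0\<bar> + \<bar>b0\<bar> + \<bar>c0\<bar> + \<bar>d0\<bar>)) ^ 3 * 0\<^sup>2)"
    unfolding E_def by (intro tendsto_intros assms)
  then have E: "E \<longlonglongrightarrow> 0" by simp
  have le: "\<bar>B n / h n ^ 3 - V n\<bar> \<le> E n" for n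
  proof -
    have in_M: "x + h n * y \<in> {x - h n * M n..(x - h n * M n) + 2 * h n * M n}" if "\<bar>y\<bar> \<le> M n" for y
    proof -
      have "\<bar>h n * y\<bar> \<le> h n * M n" using that h(2)[of n] by (simp add: abs_mult)
      then show ?thesis by (simp add: abs_le_iff mult.commute)
    qed
    have "\<bar>B n - (x + h n * b n - (x + h n * a n)) * (x + h n * d n - (x + h n * c n))
        * (x + h n * c n + (x + h n * d n) - (x + h n * a n) - (x + h n * b n)) / 2\<bar>
        \<le> \<bar>x + h n * b n - (x + h n * a n)\<bar> * \<bar>x + h n * d n - (x + h n * c n)\<bar> * (C * (2 * h n * M n) ^ 3)"
      unfolding B_def
      by (rule bracket_chords_error[of _ _ _ _ "x - h n * M n"])
        (use in_M in \<open>auto simp: M_def\<close>)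
    moreover have "(x + h n * b n - (x + h n * a n)) * (x + h n * d n - (x + h n * c n))
        * (x + h n * c n + (x + h n * d n) - (x + h n * a n) - (x + h n * b n)) / 2 = h n ^ 3 * V n"
      by (simp add: V_def power3_eq_cube algebra_simps)
    moreover have "\<bar>x + h n * b n - (x + h n * a n)\<bar> = h n * \<bar>b n - a n\<bar>"
        "\<bar>x + h n * d n - (x + h n * c n)\<bar> = h n * \<bar>d n - c n\<bar>"
      using h(2)[of n] by (simp_all add: abs_mult flip: right_diff_distrib)
    ultimately have "\<bar>B n - h n ^ 3 * V n\<bar> \<le> h n ^ 3 * E n"
      by (simp add: E_def power_mult_distrib power2_eq_square power3_eq_cube algebra_simps)
    moreover have "B n / h n ^ 3 - V n = (B n - h n ^ 3 * V n) / h n ^ 3"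
      using h(2)[of n] by (simp add: field_simps)
    ultimately show ?thesis
      using h(2)[of n] by (simp add: abs_divide field_simps)
  qed
  have "(\<lambda>n. B n / h n ^ 3 - V n) \<longlonglongrightarrow> 0"
    by (rule Lim_null_comparison[OF _ E]) (simp add: le)
  moreover have "V \<longlonglongrightarrow> (b0 - a0) * (d0 - c0) * (c0 + d0 - a0 - b0) / 2"
    unfolding V_def by (intro tendsto_intros assms) simp
  ultimately have "(\<lambda>n. (B n / h n ^ 3 - V n) + V n) \<longlonglongrightarrow> 0 + (b0 - a0) * (d0 - c0) * (c0 + d0 - a0 - b0) / 2"
    by (rule tendsto_add)
  then show ?thesis by (simp add: B_def)
qed

section \<open>Uniqueness of the other intersection, and one step of the algorithm\<close>

text \<open>Of three points on a line one lies between the other two. Those two would have to lie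
  strictly to the left of the tangent there, but they lie in opposite directions from the point of
  contact.\<close>

lemma not_collinear:
  assumes "\<beta> x \<noteq> \<beta> y" "\<beta> x \<noteq> \<beta> z" "\<beta> y \<noteq> \<beta> z"
  shows "bracket (\<beta> y - \<beta> x) (\<beta> z - \<beta> x) \<noteq> 0"
proof
  assume "bracket (\<beta> y - \<beta> x) (\<beta> z - \<beta> x) = 0"
  then obtain s where s: "\<beta> y - \<beta> x = s *\<^sub>R (\<beta> z - \<beta> x)"
    using bracket_eq_0_imp_scaleR assms by (metis eq_iff_diff_eq_0)
  define D where "D = \<beta> z - \<beta> x"
  have d: "\<beta> x - \<beta> y = (- s) *\<^sub>R D" "\<beta> z - \<beta> y = (1 - s) *\<^sub>R D" "\<beta> y - \<beta> z = (s - 1) *\<^sub>R D"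
      "\<beta> x - \<beta> z = - D"
    using s by (simp_all add: D_def algebra_simps)
  \<comment> \<open>\<open>s\<close> is the coordinate of \<open>\<beta> y\<close> on the line, with
    \<open>\<beta> x\<close> at 0 and \<open>\<beta> z\<close> at 1; the three cases tell which of
    the points is in the middle: \<open>\<beta> x\<close>, \<open>\<beta> y\<close> or
    \<open>\<beta> z\<close>.\<close>
  consider "s \<le> 0" | "0 \<le> s" "s \<le> 1" | "1 \<le> s" by linarith
  then show False
  proof cases
    case 1
    have "0 < bracket (\<beta>' x) D" "0 < s * bracket (\<beta>' x) D"
      using support[of x z] support[of x y] assms by (auto simp: s D_def bracket.scaleR_right)
    with 1 show False by (simp add: zero_less_mult_iff)
  next
    case 2
    have "0 < - s * bracket (\<beta>' y) D" "0 < (1 - s) * bracket (\<beta>' y) D"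
      using support[of y x] support[of y z] assms by (auto simp: d bracket.scaleR_right bracket.minus_right)
    with 2 show False by (simp add: zero_less_mult_iff mult_less_0_iff)
  next
    case 3
    have "0 < - bracket (\<beta>' z) D" "0 < (s - 1) * bracket (\<beta>' z) D"
      using support[of z x] support[of z y] assms by (auto simp: d bracket.scaleR_right bracket.minus_right)
    with 3 show False by (simp add: zero_less_mult_iff)
  qed
qed

lemma other_intersection_eq:
  assumes "\<beta> t \<noteq> \<beta> a" "\<beta> b \<noteq> \<beta> c" "bracket (\<beta> c - \<beta> b) (\<beta> t - \<beta> a) = 0"
  shows "other_intersection (range \<beta>) (\<beta> a) (\<beta> b) (\<beta> c) = \<beta> t"
proof -
  have "range \<beta> \<inter> parallel_line (\<beta> a) (\<beta> b) (\<beta> c) = {\<beta> a, \<beta> t}"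
  proof (intro equalityI subsetI)
    fix y assume "y \<in> range \<beta> \<inter> parallel_line (\<beta> a) (\<beta> b) (\<beta> c)"
    then obtain s where s: "y = \<beta> s" "bracket (\<beta> c - \<beta> b) (\<beta> s - \<beta> a) = 0"
      using assms by (auto simp: mem_parallel_line_iff)
    have "\<beta> c - \<beta> b \<noteq> 0" using assms by simp
    then obtain p q where "\<beta> t - \<beta> a = p *\<^sub>R (\<beta> c - \<beta> b)" "\<beta> s - \<beta> a = q *\<^sub>R (\<beta> c - \<beta> b)"
      using assms(3) s(2) bracket_eq_0_imp_scaleR bracket_commute
      by (metis add.inverse_neutral)
    then have "bracket (\<beta> t - \<beta> a) (\<beta> s - \<beta> a) = 0"
      by (simp add: bracket.scaleR_left bracket.scaleR_right)
    then have "\<beta> s = \<beta> a \<or> \<beta> s = \<beta> t" using not_collinear[of a t s] assms(1) by metis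
    then show "y \<in> {\<beta> a, \<beta> t}" using s(1) by simp
  next
    fix y assume "y \<in> {\<beta> a, \<beta> t}"
    then show "y \<in> range \<beta> \<inter> parallel_line (\<beta> a) (\<beta> b) (\<beta> c)"
      using assms by (auto simp: mem_parallel_line_iff)
  qed
  then show ?thesis
    unfolding other_intersection_def using assms(1) by (intro the_equality) auto
qed

text \<open>On a parabola the new point has t - c = b - a. The determinant \<open>F\<close> changes
  sign between \<open>c\<close> and \<open>c + 2 * (b - a)\<close>, where the main term outweighs
  the error, and at its zero the factors (c - b) (t - a) cancel. All parameters lie within 3 (b - a)
  + (c - b) \<le> 6 h, less than one period, which gives 432 = 2 * 6^3 and 864 = 4 * 6^3.\<close>

lemma trapezoid_step:
  assumes h: "0 < h" "8 * h < L" "864 * C * h\<^sup>2 < 1"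
    and ab: "h / 2 \<le> b - a" "b - a \<le> 3 / 2 * h" and bc: "h / 2 \<le> c - b" "c - b \<le> 3 / 2 * h"
  obtains t where "\<beta> t = other_intersection (range \<beta>) (\<beta> a) (\<beta> b) (\<beta> c)"
    "\<bar>(t - c) - (b - a)\<bar> \<le> 432 * C * h ^ 3"
proof -
  define F where "F t = bracket (\<beta> c - \<beta> b) (\<beta> t - \<beta> a)" for t
  define g where "g = b - a"
  have err: "\<bar>F t - (c - b) * (t - a) * (a + t - b - c) / 2\<bar> \<le> (c - b) * (t - a) * (C * (6 * h) ^ 3)"
    if "c \<le> t" "t \<le> c + 2 * g" for t
    using bracket_chords_error[of b c a t a "6 * h"] that ab bc h
    by (simp add: F_def g_def)
  \<comment> \<open>At the two ends the main term contains the factor (b - a) / 2 \<ge> h / 4, which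
    the error has to stay below.\<close>
  have small: "C * (6 * h) ^ 3 < h / 4"
  proof -
    have "864 * C * h\<^sup>2 * h < 1 * h" using h by (intro mult_strict_right_mono) auto
    then show ?thesis by (simp add: power2_eq_square power3_eq_cube)
  qed
  have c1: "F c \<le> 0"
  proof -
    have "F c \<le> (c - b) * (c - a) * (a + c - b - c) / 2 + (c - b) * (c - a) * (C * (6 * h) ^ 3)"
      using err[of c] ab h by (simp add: g_def)
    also have "a + c - b - c = - g" by (simp add: g_def)
    also have "(c - b) * (c - a) * (- g) / 2 + (c - b) * (c - a) * (C * (6 * h) ^ 3)
        = (c - b) * (c - a) * (C * (6 * h) ^ 3 - g / 2)"
      by (simp add: right_diff_distrib)
    also have "\<dots> \<le> 0"
      using small ab bc h by (intro mult_nonneg_nonpos) (auto simp: g_def)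
    finally show ?thesis .
  qed
  have c2: "0 \<le> F (c + 2 * g)"
  proof -
    have e: "a + (c + 2 * g) - b - c = g" by (simp add: g_def)
    have "0 \<le> (c - b) * (c + 2 * g - a) * (g / 2 - C * (6 * h) ^ 3)"
      using small ab bc h by (intro mult_nonneg_nonneg) (auto simp: g_def)
    also have "\<dots> = (c - b) * (c + 2 * g - a) * g / 2 - (c - b) * (c + 2 * g - a) * (C * (6 * h) ^ 3)"
      by (simp add: right_diff_distrib)
    also have "\<dots> \<le> F (c + 2 * g)"
      using err[of "c + 2 * g", unfolded e] ab h by (simp add: g_def)
    finally show ?thesis .
  qed
  have "isCont F t" for t
  proof -
    have "(F has_real_derivative bracket (\<beta> c - \<beta> b) (\<beta>' t)) (at t)"
      unfolding F_def bracket.diff_right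
      by (auto intro!: derivative_eq_intros bracket_has_real_derivative_right deriv)
    then show ?thesis by (rule DERIV_isCont)
  qed
  then obtain t where t: "c \<le> t" "t \<le> c + 2 * g" "F t = 0"
    using IVT[of F c 0 "c + 2 * g"] c1 c2 ab h by (auto simp: g_def)
  have ta: "0 < t - a" "t - a < L" "0 < c - b" "c - b < L"
    using t ab bc h by (auto simp: g_def)
  then have "\<beta> t \<noteq> \<beta> a" "\<beta> b \<noteq> \<beta> c"
    using injective_near[of a t] injective_near[of b c] by auto
  then have "\<beta> t = other_intersection (range \<beta>) (\<beta> a) (\<beta> b) (\<beta> c)"
    using other_intersection_eq[of t a b c] t(3) by (simp add: F_def)
  moreover
  have "\<bar>(c - b) * (t - a) * (a + t - b - c) / 2\<bar> = (c - b) * (t - a) * (\<bar>(t - c) - (b - a)\<bar> / 2)"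
    using ta by (simp add: abs_mult)
  with err[OF t(1,2)] t(3) have "(c - b) * (t - a) * (\<bar>(t - c) - (b - a)\<bar> / 2) \<le> (c - b) * (t - a) * (C * (6 * h) ^ 3)"
    by simp
  then have "\<bar>(t - c) - (b - a)\<bar> / 2 \<le> C * (6 * h) ^ 3"
    using ta by (simp add: mult_le_cancel_left_pos)
  then have "\<bar>(t - c) - (b - a)\<bar> \<le> 432 * C * h ^ 3"
    by (simp add: power_mult_distrib)
  ultimately show ?thesis by (rule that)
qed

text \<open>Each gap repeats the last but one up to 432 C h^3, so the deviations from
  \<open>h\<close> grow at most linearly in the index. The induction carries its own licence: as
  long as \<open>K\<close> such errors stay below h / 2, the gaps remain between h / 2 and 3 h / 2,
  as a further step requires.\<close>

lemma orbit_exists: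
  fixes x0 h :: real and K :: nat
  defines "Q \<equiv> trapezoidal (range \<beta>) (\<beta> x0) (\<beta> (x0 + h)) (\<beta> (x0 + 2 * h))"
  assumes h: "0 < h" "8 * h < L" "864 * C * h\<^sup>2 < 1"
    and K: "3 \<le> K" "K * (432 * C * h ^ 3) \<le> h / 2"
  shows "\<exists>p. p 1 = x0 \<and> p 2 = x0 + h \<and> p 3 = x0 + 2 * h \<and>
    (\<forall>j. 1 \<le> j \<and> j \<le> K \<longrightarrow> Q j = \<beta> (p j)) \<and>
    (\<forall>j. 1 \<le> j \<and> j < K \<longrightarrow> \<bar>p (Suc j) - p j - h\<bar> \<le> j * (432 * C * h ^ 3))"
  using K
proof (induction K rule: nat_induct_at_least)
  case base
  define p where "p = (\<lambda>j. x0 + (real j - 1) * h)"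
  have "Q j = \<beta> (p j)" if "1 \<le> j" "j \<le> 3" for j
  proof -
    from that have "j = 1 \<or> j = 2 \<or> j = 3" by auto
    then show ?thesis by (auto simp: p_def Q_def numeral_2_eq_2 numeral_3_eq_3)
  qed
  moreover have "\<bar>p (Suc j) - p j - h\<bar> \<le> j * (432 * C * h ^ 3)" for j
  proof -
    have "p (Suc j) - p j - h = 0" by (simp add: p_def algebra_simps)
    then show ?thesis using C_nonneg h by simp
  qed
  moreover have "p 1 = x0" "p 2 = x0 + h" "p 3 = x0 + 2 * h" by (simp_all add: p_def)
  ultimately show ?case by blast
next
  case (Suc K)
  define G where "G = 432 * C * h ^ 3"
  have G: "0 \<le> G" using C_nonneg h by (simp add: G_def)
  have KG: "real (Suc K) * G \<le> h / 2" using Suc.prems by (simp add: G_def)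
  have jG: "real j * G \<le> h / 2" if "j \<le> K" for j
  proof -
    have "real j * G \<le> real (Suc K) * G" using that G by (intro mult_right_mono) auto
    then show ?thesis using KG by simp
  qed
  obtain p where p: "p 1 = x0" "p 2 = x0 + h" "p 3 = x0 + 2 * h"
    and Q: "\<And>j. 1 \<le> j \<Longrightarrow> j \<le> K \<Longrightarrow> Q j = \<beta> (p j)"
    and gap: "\<And>j. 1 \<le> j \<Longrightarrow> j < K \<Longrightarrow> \<bar>p (Suc j) - p j - h\<bar> \<le> j * G"
    using Suc.IH jG[of K] unfolding G_def by auto
  obtain i where i: "K = Suc (Suc (Suc i))"
    using Suc.hyps by (metis Suc_le_D numeral_3_eq_3 Suc_le_mono)
  have g1: "\<bar>p (Suc (Suc i)) - p (Suc i) - h\<bar> \<le> Suc i * G"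
    and g2: "\<bar>p (Suc (Suc (Suc i))) - p (Suc (Suc i)) - h\<bar> \<le> Suc (Suc i) * G"
    using gap[of "Suc i"] gap[of "Suc (Suc i)"] i by auto
  have b: "Suc i * G \<le> h / 2" "Suc (Suc i) * G \<le> h / 2"
    using jG[of "Suc i"] jG[of "Suc (Suc i)"] i by auto
  obtain t where t: "\<beta> t = other_intersection (range \<beta>) (\<beta> (p (Suc i))) (\<beta> (p (Suc (Suc i)))) (\<beta> (p K))"
      "\<bar>(t - p K) - (p (Suc (Suc i)) - p (Suc i))\<bar> \<le> 432 * C * h ^ 3"
  proof (rule trapezoid_step[where a = "p (Suc i)" and b = "p (Suc (Suc i))" and c = "p K", OF h])
    show "h / 2 \<le> p (Suc (Suc i)) - p (Suc i)" "p (Suc (Suc i)) - p (Suc i) \<le> 3 / 2 * h"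
      using g1 b(1) by linarith+
    show "h / 2 \<le> p K - p (Suc (Suc i))" "p K - p (Suc (Suc i)) \<le> 3 / 2 * h"
      unfolding i using g2 b(2) by linarith+
  qed
  define p' where "p' = p(Suc K := t)"
  have "Q j = \<beta> (p' j)" if "1 \<le> j" "j \<le> Suc K" for j
  proof (cases "j = Suc K")
    case True
    then have "Q j = other_intersection (range \<beta>) (Q (Suc i)) (Q (Suc (Suc i))) (Q (Suc (Suc (Suc i))))"
      by (simp add: Q_def i)
    also have "\<dots> = \<beta> t" using t Q i by auto
    finally show ?thesis using True by (simp add: p'_def)
  qed (use that Q in \<open>auto simp: p'_def\<close>)
  moreover have "\<bar>p' (Suc j) - p' j - h\<bar> \<le> j * G" if "1 \<le> j" "j < Suc K" for j
  proof (cases "j = K")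
    case True
    \<comment> \<open>The new gap is compared with gap number \<open>Suc i\<close>, which is
      \<open>K - 2\<close>; one additional error gives \<open>K - 1\<close>, within the allowance of
      \<open>K\<close>.\<close>
    have "\<bar>t - p K - h\<bar> \<le> G + Suc i * G" using t(2) g1 unfolding G_def by linarith
    also have "\<dots> \<le> real K * G" using G by (simp add: i algebra_simps)
    finally show ?thesis by (simp add: True p'_def)
  qed (use that gap in \<open>auto simp: p'_def\<close>)
  moreover have "p' 1 = x0" "p' 2 = x0 + h" "p' 3 = x0 + 2 * h"
    using p by (simp_all add: p'_def i)
  ultimately show ?case unfolding G_def by blast
qed

section \<open>Positivity on short arcs, and limits of scaled chords\<close>

lemma bracket_deriv_pos:
  obtains \<delta> where "0 < \<delta>" "\<And>x y. x < y \<Longrightarrow> y < x + \<delta> \<Longrightarrow> 0 < bracket (\<beta>' x) (\<beta>' y)"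
proof
  \<comment> \<open>For e = y - x the error C e^3 stays below e once C e^2 < 1; as \<delta> \<le> 1,
    this follows from e^2 \<le> e < \<delta>.\<close>
  define \<delta> where "\<delta> = 1 / (C + 1)"
  show "0 < \<delta>" using C_nonneg by (simp add: \<delta>_def)
  fix x y :: real assume xy: "x < y" "y < x + \<delta>"
  define e where "e = y - x"
  have e: "0 < e" "e < \<delta>" using xy by (simp_all add: e_def)
  have "\<delta> \<le> 1" using C_nonneg by (simp add: \<delta>_def)
  then have "e * e \<le> 1 * e" using e by (intro mult_right_mono) auto
  then have "e * e < \<delta>" using e by linarith
  then have "(C + 1) * (e * e) < (C + 1) * \<delta>"
    using C_nonneg by (intro mult_strict_left_mono) auto
  also have "\<dots> = 1" using C_nonneg by (simp add: \<delta>_def)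
  finally have "((C + 1) * (e * e)) * e < 1 * e" using e by (intro mult_strict_right_mono) auto
  moreover have "0 < e * e * e" using e by simp
  ultimately have "C * e ^ 3 < e" by (simp add: power3_eq_cube algebra_simps)
  then show "0 < bracket (\<beta>' x) (\<beta>' y)"
    using approx[of x y] e by (simp add: abs_le_iff flip: e_def)
qed

text \<open>The sign holds for all chords on an arc shorter than \<delta>, whatever their sizes
  relative to each other. This covers the scales between h and 1, where no limit is
  available.\<close>

lemma bracket_chords_pos:
  obtains \<delta> where "0 < \<delta>"
    "\<And>a b c d. a < b \<Longrightarrow> b \<le> c \<Longrightarrow> c < d \<Longrightarrow> d < a + \<delta> \<Longrightarrow> 0 < bracket (\<beta> b - \<beta> a) (\<beta> d - \<beta> c)"
proof -
  obtain \<delta> where \<delta>: "0 < \<delta>" "\<And>x y. x < y \<Longrightarrow> y < x + \<delta> \<Longrightarrow> 0 < bracket (\<beta>' x) (\<beta>' y)"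
    using bracket_deriv_pos by blast
  have "0 < bracket (\<beta> b - \<beta> a) (\<beta> d - \<beta> c)"
    if "a < b" "b \<le> c" "c < d" "d < a + \<delta>" for a b c d
  proof -
    obtain \<xi> where \<xi>: "a < \<xi>" "\<xi> < b"
      "bracket (\<beta> b) (\<beta> d - \<beta> c) - bracket (\<beta> a) (\<beta> d - \<beta> c) = (b - a) * bracket (\<beta>' \<xi>) (\<beta> d - \<beta> c)"
      using MVT2[OF \<open>a < b\<close> bracket_has_real_derivative_left[OF deriv]] by blast
    obtain \<eta> where \<eta>: "c < \<eta>" "\<eta> < d"
      "bracket (\<beta>' \<xi>) (\<beta> d) - bracket (\<beta>' \<xi>) (\<beta> c) = (d - c) * bracket (\<beta>' \<xi>) (\<beta>' \<eta>)"
      using MVT2[OF \<open>c < d\<close> bracket_has_real_derivative_right[OF deriv]] by blast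
    have "bracket (\<beta> b - \<beta> a) (\<beta> d - \<beta> c) = (b - a) * ((d - c) * bracket (\<beta>' \<xi>) (\<beta>' \<eta>))"
      using \<xi>(3) \<eta>(3) by (simp add: bracket.diff_left bracket.diff_right)
    moreover have "0 < bracket (\<beta>' \<xi>) (\<beta>' \<eta>)" using \<xi> \<eta> that by (intro \<delta>(2)) auto
    ultimately show ?thesis using that by simp
  qed
  with \<delta>(1) that show ?thesis by blast
qed

text \<open>Both ends of the chord move. The mean value theorem is applied to each coordinate
  separately, with its own intermediate point.\<close>

lemma chord_tendsto:
  assumes a: "a \<longlonglongrightarrow> y" and b: "b \<longlonglongrightarrow> y" and q: "(\<lambda>n. (b n - a n) / h n) \<longlonglongrightarrow> c"
  shows "(\<lambda>n. (1 / h n) *\<^sub>R (\<beta> (b n) - \<beta> (a n))) \<longlonglongrightarrow> c *\<^sub>R \<beta>' y"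
proof (rule vec_tendstoI)
  fix i :: 2
  have "((\<lambda>x. \<beta> x $ i) has_real_derivative \<beta>' x $ i) (at x)" for x
    using bounded_linear.has_vector_derivative[OF bounded_linear_vec_nth deriv]
    by (simp add: has_real_derivative_iff_has_vector_derivative)
  then have "\<exists>\<xi>. \<xi> \<in> closed_segment (a n) (b n) \<and> \<beta> (b n) $ i - \<beta> (a n) $ i = (b n - a n) * \<beta>' \<xi> $ i" for n
    using mvt_closed_segment[of "\<lambda>x. \<beta> x $ i" "\<lambda>x. \<beta>' x $ i" "a n" "b n"] by blast
  then obtain \<xi> where \<xi>: "\<And>n. \<xi> n \<in> closed_segment (a n) (b n)"
    "\<And>n. \<beta> (b n) $ i - \<beta> (a n) $ i = (b n - a n) * \<beta>' (\<xi> n) $ i" by metis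
  have "\<xi> \<longlonglongrightarrow> y"
  proof (rule tendsto_sandwich)
    show "\<forall>\<^sub>F n in sequentially. min (a n) (b n) \<le> \<xi> n" "\<forall>\<^sub>F n in sequentially. \<xi> n \<le> max (a n) (b n)"
      using \<xi>(1) by (auto simp: closed_segment_eq_real_ivl min_def max_def split: if_splits intro!: always_eventually)
        (smt (verit) atLeastAtMost_iff)+
    show "(\<lambda>n. min (a n) (b n)) \<longlonglongrightarrow> y" "(\<lambda>n. max (a n) (b n)) \<longlonglongrightarrow> y"
      using tendsto_min[OF a b] tendsto_max[OF a b] by simp_all
  qed
  then have "(\<lambda>n. \<beta>' (\<xi> n)) \<longlonglongrightarrow> \<beta>' y"
    using cont by (simp add: continuous_on_eq_continuous_at isCont_tendsto_compose)
  then have "(\<lambda>n. (b n - a n) / h n * \<beta>' (\<xi> n) $ i) \<longlonglongrightarrow> c * \<beta>' y $ i"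
    by (intro tendsto_intros q)
  then show "(\<lambda>n. ((1 / h n) *\<^sub>R (\<beta> (b n) - \<beta> (a n))) $ i) \<longlonglongrightarrow> (c *\<^sub>R \<beta>' y) $ i"
    by (simp add: \<xi>(2))
qed

lemma \<beta>_tendsto: "a \<longlonglongrightarrow> y \<Longrightarrow> (\<lambda>n. \<beta> (a n)) \<longlonglongrightarrow> \<beta> y"
  by (rule isCont_tendsto_compose[OF has_vector_derivative_continuous[OF deriv]])

end

text \<open>Compactness gives uniformity in \<open>k\<close>. Failures for infinitely many
  \<open>n\<close> yield pairs \<open>(r i, k i)\<close> along which, after thinning out, the
  bounded quantity \<open>f\<close> converges; a single good pair then contradicts the
  choice.\<close>

lemma eventually_sequentially_by_subsequences:
  fixes f :: "nat \<Rightarrow> nat \<Rightarrow> real"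
  assumes range: "\<And>n k. S n k \<Longrightarrow> lo \<le> f n k \<and> f n k \<le> hi"
    and sub: "\<And>r k y. strict_mono (r :: nat \<Rightarrow> nat) \<Longrightarrow> (\<And>i. S (r i) (k i)) \<Longrightarrow>
      (\<lambda>i. f (r i) (k i)) \<longlonglongrightarrow> y \<Longrightarrow> lo \<le> y \<Longrightarrow> y \<le> hi \<Longrightarrow> \<exists>i. R (r i) (k i)"
  shows "\<forall>\<^sub>F n in sequentially. \<forall>k. S n k \<longrightarrow> R n k"
proof (rule ccontr)
  assume "\<not> ?thesis"
  then obtain r :: "nat \<Rightarrow> nat" where r: "strict_mono r" "\<And>i. \<not> (\<forall>k. S (r i) k \<longrightarrow> R (r i) k)"
    using not_eventually_sequentiallyD[of "\<lambda>n. \<forall>k. S n k \<longrightarrow> R n k"] by blast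
  then have "\<forall>i. \<exists>k. S (r i) k \<and> \<not> R (r i) k" by blast
  then obtain k where k: "\<And>i. S (r i) (k i)" "\<And>i. \<not> R (r i) (k i)" by metis
  define g where "g i = f (r i) (k i)" for i
  have "\<forall>i. g i \<in> {lo..hi}" using range k by (auto simp: g_def)
  then obtain y and s :: "nat \<Rightarrow> nat" where s: "y \<in> {lo..hi}" "strict_mono s" "(g \<circ> s) \<longlonglongrightarrow> y"
    using compact_Icc[of lo hi] unfolding compact_eq_seq_compact_metric seq_compact_def by blast
  have "\<exists>i. R ((r \<circ> s) i) ((k \<circ> s) i)"
    using s r k by (intro sub[of "r \<circ> s" "k \<circ> s" y]) (auto simp: strict_mono_def o_def g_def)
  then show False using k by auto
qed

section \<open>The orbit of the trapezoidal algorithm\<close>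

lemma lim_const_over_subseq:
  fixes c :: real
  assumes "strict_mono r"
  shows "(\<lambda>i. c / real (r i)) \<longlonglongrightarrow> 0"
  using LIMSEQ_subseq_LIMSEQ[OF lim_const_over_n[of c] assms] by (simp add: o_def)

context affine_curve
begin

text \<open>The range up to \<open>2 * n\<close> leaves room for a full turn in spite of the drift,
  so that the return to the initial point is covered.\<close>

lemma orbit_asymptotics:
  obtains E p where "0 \<le> (E::real)"
    "\<forall>\<^sub>F n in sequentially. 4 \<le> n \<and> p n 1 = x0 \<and> p n 2 = x0 + L / n \<and> p n 3 = x0 + 2 * (L / n) \<and>
      (\<forall>j. 1 \<le> j \<and> j \<le> 2 * n \<longrightarrow>
        trapezoidal (range \<beta>) (\<beta> x0) (\<beta> (x0 + L / n)) (\<beta> (x0 + 2 * (L / n))) j = \<beta> (p n j)) \<and>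
      (\<forall>j. 1 \<le> j \<and> j < 2 * n \<longrightarrow> \<bar>p n (Suc j) - p n j - L / n\<bar> \<le> E / (real n)\<^sup>2) \<and>
      (\<forall>j. 1 \<le> j \<and> j \<le> 2 * n \<longrightarrow> \<bar>p n j - x0 - (real j - 1) * (L / n)\<bar> \<le> E / n)"
proof -
  \<comment> \<open>In \<open>2 * n\<close> steps a gap deviates by at most 2 n * 432 C h^3 = E / (2
    n^2), and \<open>2 * n\<close> such deviations add up to E / n.\<close>
  define E where "E = 1728 * C * L ^ 3"
  have E: "0 \<le> E" using C_nonneg L_pos by (simp add: E_def)
  define R where "R n p \<longleftrightarrow> 4 \<le> n \<and> p 1 = x0 \<and> p 2 = x0 + L / n \<and> p 3 = x0 + 2 * (L / n) \<and>
      (\<forall>j. 1 \<le> j \<and> j \<le> 2 * n \<longrightarrow>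
        trapezoidal (range \<beta>) (\<beta> x0) (\<beta> (x0 + L / n)) (\<beta> (x0 + 2 * (L / n))) j = \<beta> (p j)) \<and>
      (\<forall>j. 1 \<le> j \<and> j < 2 * n \<longrightarrow> \<bar>p (Suc j) - p j - L / n\<bar> \<le> E / (real n)\<^sup>2) \<and>
      (\<forall>j. 1 \<le> j \<and> j \<le> 2 * n \<longrightarrow> \<bar>p j - x0 - (real j - 1) * (L / n)\<bar> \<le> E / n)" for n :: nat and p :: "nat \<Rightarrow> real"
  have inv: "(\<lambda>n. c / real n) \<longlonglongrightarrow> 0" for c :: real
    by (rule lim_const_over_n)
  have "(\<lambda>n. 864 * C * (L / real n)\<^sup>2) \<longlonglongrightarrow> 864 * C * 0\<^sup>2"
    by (intro tendsto_intros inv)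
  then have 1: "\<forall>\<^sub>F n in sequentially. 864 * C * (L / real n)\<^sup>2 < 1"
    by (intro order_tendstoD(2)) auto
  have 2: "\<forall>\<^sub>F n in sequentially. E / real n < L"
    using inv L_pos by (rule order_tendstoD(2))
  have "\<forall>\<^sub>F n in sequentially. \<exists>p. R n p"
    using 1 2 eventually_ge_at_top[of 9]
  proof eventually_elim
    case (elim n)
    define h where "h = L / real n"
    have h: "0 < h" "8 * h < L" "864 * C * h\<^sup>2 < 1" "real n * h = L"
      using elim L_pos by (simp_all add: h_def field_simps)
    define G where "G = 432 * C * h ^ 3"
    have G: "0 \<le> G" using C_nonneg h by (simp add: G_def)
    have "real (2 * n) * G = 864 * C * (real n * h) * h ^ 2"
      by (simp add: G_def power2_eq_square power3_eq_cube)
    also have "\<dots> = E / 2 / (real n)\<^sup>2"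
      unfolding h(4) by (simp add: E_def h_def power_divide power2_eq_square power3_eq_cube)
    finally have nG: "real (2 * n) * G = E / 2 / (real n)\<^sup>2" .
    have jG: "real j * G \<le> E / 2 / (real n)\<^sup>2" if "j \<le> 2 * n" for j
    proof -
      have "real j * G \<le> real (2 * n) * G" using that G by (intro mult_right_mono) auto
      then show ?thesis using nG by simp
    qed
    have "E / 2 / (real n)\<^sup>2 \<le> h / 2"
      using elim by (simp add: h_def power2_eq_square field_simps)
    then have K: "3 \<le> 2 * n" "real (2 * n) * (432 * C * h ^ 3) \<le> h / 2"
      using nG elim by (auto simp: G_def)
    obtain p where p: "p 1 = x0" "p 2 = x0 + h" "p 3 = x0 + 2 * h"
      and Q: "\<And>j. 1 \<le> j \<Longrightarrow> j \<le> 2 * n \<Longrightarrow>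
        trapezoidal (range \<beta>) (\<beta> x0) (\<beta> (x0 + h)) (\<beta> (x0 + 2 * h)) j = \<beta> (p j)"
      and gap: "\<And>j. 1 \<le> j \<Longrightarrow> j < 2 * n \<Longrightarrow> \<bar>p (Suc j) - p j - h\<bar> \<le> j * G"
      using orbit_exists[OF h(1-3) K, of x0] unfolding G_def by blast
    have gap': "\<bar>p (Suc j) - p j - h\<bar> \<le> E / 2 / (real n)\<^sup>2" if "1 \<le> j" "j < 2 * n" for j
      using gap[OF that] jG[of j] that by simp
    define e where "e = E / 2 / (real n)\<^sup>2"
    have pos: "\<bar>p (Suc j) - x0 - real j * h\<bar> \<le> real j * e" if "j < 2 * n" for j
      using that
    proof (induction j)
      case 0
      then show ?case using p(1) by simp
    next
      case (Suc j)
      then show ?case using gap'[of "Suc j"] unfolding e_def[symmetric] by (simp add: algebra_simps)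
    qed
    have "\<bar>p j - x0 - (real j - 1) * h\<bar> \<le> E / n" if j: "1 \<le> j" "j \<le> 2 * n" for j
    proof -
      obtain i where i: "j = Suc i" using j by (cases j) auto
      have "real i * (E / 2 / (real n)\<^sup>2) \<le> real (2 * n) * (E / 2 / (real n)\<^sup>2)"
        using E j i by (intro mult_right_mono) auto
      also have "\<dots> = E / n" using elim by (simp add: power2_eq_square)
      finally show ?thesis using pos[of i] j i by (simp add: e_def)
    qed
    moreover have "E / 2 / (real n)\<^sup>2 \<le> E / (real n)\<^sup>2"
      using E by (intro divide_right_mono) auto
    ultimately show ?case
      using p Q gap' elim unfolding R_def h_def[symmetric] by (intro exI[of _ p]) force
  qed
  then have "\<forall>\<^sub>F n in sequentially. R n (SOME p. R n p)"
    by (rule eventually_mono) (metis someI_ex)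
  then show ?thesis unfolding R_def by (rule that[OF E])
qed

end

text \<open>The lifts \<open>p n j\<close> of the points to the arc length parameter do not wrap
  around, so that indices and positions are compared as real numbers; beyond the common threshold
  \<open>N\<close> all bounds are available.\<close>

locale trapezoidal_orbit = affine_curve +
  fixes x0 E :: real and p :: "nat \<Rightarrow> nat \<Rightarrow> real" and P :: "nat \<Rightarrow> nat \<Rightarrow> real^2" and N :: nat
  assumes E_nonneg: "0 \<le> E"
    and N: "4 \<le> N"
    and p_init: "N \<le> n \<Longrightarrow> p n 1 = x0" "N \<le> n \<Longrightarrow> p n 2 = x0 + L / n" "N \<le> n \<Longrightarrow> p n 3 = x0 + 2 * (L / n)"
    and P_eq: "N \<le> n \<Longrightarrow> 1 \<le> j \<Longrightarrow> j \<le> 2 * n \<Longrightarrow> P n j = \<beta> (p n j)"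
    and gap: "N \<le> n \<Longrightarrow> 1 \<le> j \<Longrightarrow> j < 2 * n \<Longrightarrow> \<bar>p n (Suc j) - p n j - L / n\<bar> \<le> E / (real n)\<^sup>2"
    and drift: "N \<le> n \<Longrightarrow> 1 \<le> j \<Longrightarrow> j \<le> 2 * n \<Longrightarrow> \<bar>p n j - x0 - (real j - 1) * (L / n)\<bar> \<le> E / n"
begin

section \<open>Gaps in the limit, and exclusion of stopping shortly after the start\<close>

lemma gap_scaled_tendsto:
  assumes r: "strict_mono r" "\<And>i. N \<le> r i" and k: "\<And>i. 1 \<le> k i" "\<And>i. k i < 2 * r i"
  shows "(\<lambda>i. (p (r i) (Suc (k i)) - p (r i) (k i)) / (L / r i)) \<longlonglongrightarrow> 1"
proof -
  have "norm ((p (r i) (Suc (k i)) - p (r i) (k i)) / (L / r i) - 1) \<le> E / L / real (r i)" for i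
  proof -
    have n: "0 < real (r i)" using r(2)[of i] N by simp
    have "\<bar>p (r i) (Suc (k i)) - p (r i) (k i) - L / r i\<bar> / (L / r i) \<le> E / (real (r i))\<^sup>2 / (L / r i)"
      using gap[OF r(2) k] L_pos n by (intro divide_right_mono) auto
    moreover have "(p (r i) (Suc (k i)) - p (r i) (k i)) / (L / r i) - 1
        = (p (r i) (Suc (k i)) - p (r i) (k i) - L / r i) / (L / r i)"
      using n L_pos by (simp add: field_simps)
    ultimately show ?thesis
      using n L_pos by (simp add: abs_divide abs_mult power2_eq_square mult.commute)
  qed
  then have "(\<lambda>i. (p (r i) (Suc (k i)) - p (r i) (k i)) / (L / r i) - 1) \<longlonglongrightarrow> 0"
    by (intro Lim_null_comparison[OF _ lim_const_over_subseq[OF r(1)]] always_eventually allI)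
  then show ?thesis by (simp add: LIM_zero_iff)
qed

lemma eventually_increasing:
  "\<forall>\<^sub>F n in sequentially. \<forall>i j. 1 \<le> i \<and> i < j \<and> j \<le> 2 * n \<longrightarrow> p n i < p n j"
proof -
  have "\<forall>\<^sub>F n in sequentially. E / real n < L"
    using lim_const_over_n L_pos by (rule order_tendstoD(2))
  then show ?thesis
    using eventually_ge_at_top[of N]
  proof eventually_elim
    case (elim n)
    then have n: "0 < real n" using N by simp
    have step: "p n j < p n (Suc j)" if "1 \<le> j" "j < 2 * n" for j
    proof -
      have "E / (real n)\<^sup>2 < L / n" using elim n by (simp add: field_simps power2_eq_square)
      then show ?thesis using gap[OF elim(2) that] by linarith
    qed
    have "p n i < p n j" if "1 \<le> i" "i < j" "j \<le> 2 * n" for i j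
      using that(2,3)
    proof (induction j)
      case (Suc j)
      then show ?case using step[of j] that(1) by (cases "i = j") force+
    qed simp
    then show ?case by blast
  qed
qed

text \<open>This index is special, since \<open>r2\<close> passes through P_2, which precedes P_3,
  so that B has a negative coordinate on \<open>r3\<close> like A. On the parabola with abscissae 0,
  1, 2, 3 the coordinates of A and B are -1 and -1/2: A lies beyond B.\<close>

lemma no_stop_at_4: "\<forall>\<^sub>F n in sequentially. \<not> stopping_condition (P n) 4"
proof -
  define r :: "nat \<Rightarrow> nat" where "r i = i + N" for i
  define h where "h i = L / r i" for i
  have r: "strict_mono r" "\<And>i. N \<le> r i" by (auto simp: r_def strict_mono_def)
  have h: "h \<longlonglongrightarrow> 0" "\<And>i. 0 < h i"
    unfolding h_def using lim_const_over_subseq[OF r(1)] L_pos N by (simp_all add: r_def)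
  define q where "q i = (p (r i) 4 - x0) / h i" for i
  have "(\<lambda>i. (p (r i) (Suc 3) - p (r i) 3) / h i + 2) \<longlonglongrightarrow> 1 + 2"
    unfolding h_def using r N by (intro tendsto_intros gap_scaled_tendsto) (auto intro: order_less_le_trans[of _ "2 * N"])
  moreover have "(p (r i) (Suc 3) - p (r i) 3) / h i + 2 = q i" for i
    using p_init(3)[OF r(2)] h(2)[of i] by (simp add: q_def field_simps flip: h_def)
  ultimately have q: "q \<longlonglongrightarrow> 3" by simp
  have P: "P (r i) 1 = \<beta> (x0 + h i * 0)" "P (r i) 2 = \<beta> (x0 + h i * 1)" "P (r i) 3 = \<beta> (x0 + h i * 2)"
      "P (r i) 4 = \<beta> (x0 + h i * q i)" for i
  proof -
    have "4 \<le> r i" using r(2)[of i] N by simp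
    then show "P (r i) 1 = \<beta> (x0 + h i * 0)" "P (r i) 2 = \<beta> (x0 + h i * 1)" "P (r i) 3 = \<beta> (x0 + h i * 2)"
      "P (r i) 4 = \<beta> (x0 + h i * q i)"
      using P_eq[OF r(2)] p_init[OF r(2)] h(2)[of i] by (auto simp: h_def q_def mult.commute)
  qed
  define u w d where "u i = P (r i) 2 - P (r i) 1" and "w i = P (r i) 4 - P (r i) 3"
    and "d i = P (r i) 4 - P (r i) 1" for i
  have lims: "(\<lambda>i. bracket (\<beta> (x0 + h i * b) - \<beta> (x0 + h i * a)) (\<beta> (x0 + h i * d i) - \<beta> (x0 + h i * c)) / h i ^ 3)
      \<longlonglongrightarrow> (b - a) * (d0 - c) * (c + d0 - a - b) / 2" if "d \<longlonglongrightarrow> d0" for a b c d d0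
    using bracket_chords_tendsto[OF h tendsto_const tendsto_const tendsto_const that] .
  have 1: "(\<lambda>i. bracket (u i) (w i) / h i ^ 3) \<longlonglongrightarrow> 2"
    unfolding u_def w_def P using lims[OF q, where a = 0 and b = 1 and c = 2] by simp
  have 2: "(\<lambda>i. bracket (u i) (d i) / h i ^ 3) \<longlonglongrightarrow> 3"
    unfolding u_def d_def P using lims[OF q, where a = 0 and b = 1 and c = 0] by simp
  have 3: "(\<lambda>i. bracket (P (r i) 1 - P (r i) 3) (d i) / h i ^ 3) \<longlonglongrightarrow> -3"
    unfolding d_def P using lims[OF q, where a = 2 and b = 0 and c = 0] by simp
  have 4: "(\<lambda>i. bracket (P (r i) 2 - P (r i) 3) (w i) / h i ^ 3) \<longlonglongrightarrow> -1"
    unfolding w_def P using lims[OF q, where a = 2 and b = 1 and c = 2] by simp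
  have 5: "(\<lambda>i. bracket (u i) (P (r i) 3 - P (r i) 1) / h i ^ 3) \<longlonglongrightarrow> 1"
    unfolding u_def P
    using lims[OF tendsto_const[of 2], where a = 0 and b = 1 and c = 0] by simp
  \<comment> \<open>The coordinate of B minus that of A, multiplied by the two denominators [u, w]
    and [u, d].\<close>
  have "(\<lambda>i. (bracket (P (r i) 2 - P (r i) 3) (w i) / h i ^ 3) * (bracket (u i) (d i) / h i ^ 3)
       - (bracket (P (r i) 1 - P (r i) 3) (d i) / h i ^ 3) * (bracket (u i) (w i) / h i ^ 3)) \<longlonglongrightarrow> (-1) * 3 - (-3) * 2"
    by (intro tendsto_intros 1 2 3 4)
  then have 6: "\<forall>\<^sub>F i in sequentially. 0 < (bracket (P (r i) 2 - P (r i) 3) (w i) / h i ^ 3) * (bracket (u i) (d i) / h i ^ 3)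
       - (bracket (P (r i) 1 - P (r i) 3) (d i) / h i ^ 3) * (bracket (u i) (w i) / h i ^ 3)"
    by (rule order_tendstoD(1)) simp
  have "\<forall>\<^sub>F i in sequentially. \<not> stopping_condition (P (r i)) 4"
    using order_tendstoD(1)[OF 1, of 0, simplified] order_tendstoD(1)[OF 2, of 0, simplified]
      order_tendstoD(2)[OF 3, of 0, simplified] order_tendstoD(1)[OF 5, of 0, simplified] 6
  proof eventually_elim
    case (elim i)
    have h3: "0 < h i ^ 3" using h(2) by simp
    then have pos: "0 < bracket (u i) (w i)" "0 < bracket (u i) (d i)"
      "bracket (P (r i) 1 - P (r i) 3) (d i) < 0" "0 < bracket (u i) (P (r i) 3 - P (r i) 1)"
      using elim(1-4) by (simp_all add: zero_less_divide_iff divide_less_0_iff)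
    have "0 < (bracket (P (r i) 2 - P (r i) 3) (w i) * bracket (u i) (d i)
       - bracket (P (r i) 1 - P (r i) 3) (d i) * bracket (u i) (w i)) / (h i ^ 3 * h i ^ 3)"
      using elim(5) by (simp add: diff_divide_distrib)
    then have less: "bracket (P (r i) 1 - P (r i) 3) (d i) * bracket (u i) (w i)
        < bracket (P (r i) 2 - P (r i) 3) (w i) * bracket (u i) (d i)"
      using h3 by (simp add: zero_less_divide_iff)
    show ?case
    proof
      assume stop: "stopping_condition (P (r i)) 4"
      have nz: "bracket (u i) (d i) \<noteq> 0" "bracket (u i) (P (r i) 3 - P (r i) 1) \<noteq> 0" "w i \<noteq> 0"
        using pos by auto
      obtain s \<theta> where s: "0 < \<theta>" "\<theta> < 1"
        "\<theta> * s * bracket (u i) (d i) = bracket (P (r i) 1 - P (r i) 3) (d i)"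
        "s * bracket (u i) (w i) = bracket (P (r i) 2 - P (r i) 3) (w i)"
        using stopping_conditionD[OF stop, of thesis] nz unfolding u_def w_def d_def by simp
      have "\<theta> * s < 0" using s(3) pos by (metis mult_less_0_iff not_less_iff_gr_or_eq)
      then have "s < 0" using s(1) by (simp add: mult_less_0_iff)
      then have "s < \<theta> * s" using s(1,2) by simp
      then have "s * (bracket (u i) (w i) * bracket (u i) (d i)) < \<theta> * s * (bracket (u i) (w i) * bracket (u i) (d i))"
        using pos by (intro mult_strict_right_mono) auto
      moreover have "\<theta> * s * bracket (u i) (d i) * bracket (u i) (w i) < s * bracket (u i) (w i) * bracket (u i) (d i)"
        unfolding s(3,4) by (rule less)
      ultimately show False by (simp add: mult_ac)
    qed
  qed
  then show ?thesis
    unfolding r_def using eventually_sequentially_seg[of "\<lambda>n. \<not> stopping_condition (P n) 4" N] by blast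
qed

text \<open>For \<open>k \<ge> 5\<close> on a short arc signs suffice: the line from P_k to P_1
  meets \<open>r3\<close> at a negative coordinate, while \<open>r2\<close> starts from a point not
  before P_3 and gives B a nonnegative one. So A is not between P_3 and B.\<close>

lemma no_stop_near_start:
  obtains \<delta> where "0 < \<delta>"
    "\<forall>\<^sub>F n in sequentially. \<forall>k. 4 \<le> k \<and> k \<le> 2 * n \<and> p n k \<le> x0 + \<delta> \<longrightarrow> \<not> stopping_condition (P n) k"
proof -
  obtain \<delta> where \<delta>: "0 < \<delta>"
    "\<And>a b c d. a < b \<Longrightarrow> b \<le> c \<Longrightarrow> c < d \<Longrightarrow> d < a + \<delta> \<Longrightarrow> 0 < bracket (\<beta> b - \<beta> a) (\<beta> d - \<beta> c)"
    using bracket_chords_pos by blast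
  have "\<forall>\<^sub>F n in sequentially. \<forall>k. 4 \<le> k \<and> k \<le> 2 * n \<and> p n k \<le> x0 + \<delta> / 2 \<longrightarrow> \<not> stopping_condition (P n) k"
    using no_stop_at_4 eventually_increasing eventually_ge_at_top[of N]
  proof eventually_elim
    case (elim n)
    show ?case
    proof (intro allI impI notI)
      fix k assume k: "4 \<le> k \<and> k \<le> 2 * n \<and> p n k \<le> x0 + \<delta> / 2" and stop: "stopping_condition (P n) k"
      have "k \<noteq> 4" using stop elim(1) by auto
      then have k5: "5 \<le> k" using k by linarith
      have P: "P n j = \<beta> (p n j)" if "1 \<le> j" "j \<le> k" for j using P_eq[OF elim(3)] that k by simp
      have inc: "p n i < p n j" if "1 \<le> i" "i < j" "j \<le> k" for i j using elim(2) that k by simp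
      have lt: "p n k < p n 1 + \<delta>" using k \<delta>(1) p_init(1)[OF elim(3)] by simp
      have chord: "0 < bracket (P n b - P n a) (P n d - P n c)" if "1 \<le> a" "a < b" "b \<le> c" "c < d" "d \<le> k" for a b c d
      proof -
        have "p n b \<le> p n c" using inc[of b c] that by (cases "b = c") auto
        moreover have "p n d \<le> p n k" using inc[of d k] that by (cases "d = k") auto
        moreover have "p n 1 \<le> p n a" using inc[of 1 a] that by (cases "a = 1") auto
        ultimately have "0 < bracket (\<beta> (p n b) - \<beta> (p n a)) (\<beta> (p n d) - \<beta> (p n c))"
          using lt that by (intro \<delta>(2) inc) auto
        then show ?thesis using P that by simp
      qed
      define u w d where "u = P n 2 - P n 1" and "w = P n k - P n (k - 1)" and "d = P n k - P n 1"
      have "bracket u d = bracket (P n 2 - P n 1) (P n k - P n 2)"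
        by (simp add: u_def d_def bracket_eq algebra_simps)
      then have ud: "0 < bracket u d" using chord[of 1 2 2 k] k5 by simp
      have "bracket u (P n 3 - P n 1) = bracket (P n 2 - P n 1) (P n 3 - P n 2)"
        by (simp add: u_def bracket_eq algebra_simps)
      then have u3: "0 < bracket u (P n 3 - P n 1)" using chord[of 1 2 2 3] k5 by simp
      have "bracket (P n 1 - P n 3) d = - bracket (P n 3 - P n 1) (P n k - P n 3)"
        by (simp add: d_def bracket_eq algebra_simps)
      then have 3: "bracket (P n 1 - P n 3) d < 0" using chord[of 1 3 3 k] k5 by simp
      have uw: "0 < bracket u w" using chord[of 1 2 "k - 1" k] k5 by (simp add: u_def w_def)
      \<comment> \<open>For \<open>k = 5\<close> the point P_(k-2) is P_3 itself, and the
        determinant vanishes.\<close>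
      have 4: "0 \<le> bracket (P n (k - 2) - P n 3) w"
      proof (cases "k = 5")
        case False
        then have "3 < k - 2" "k - 2 \<le> k - 1" "k - 1 < k" using k5 by linarith+
        then show ?thesis using chord[of 3 "k - 2" "k - 1" k] by (simp add: w_def)
      qed simp
      obtain s \<theta> where s: "0 < \<theta>" "\<theta> < 1" "\<theta> * s * bracket u d = bracket (P n 1 - P n 3) d"
        "s * bracket u w = bracket (P n (k - 2) - P n 3) w"
        using stopping_conditionD[OF stop] ud u3 uw unfolding u_def w_def d_def
        by (metis bracket.zero_right less_irrefl)
      have "0 \<le> s" using s(4) 4 uw by (metis zero_le_mult_iff not_less)
      then have "0 \<le> \<theta> * s * bracket u d" using s(1) ud by simp
      then show False using s(3) 3 by simp
    qed
  qed
  with \<delta>(1) that[of "\<delta> / 2"] show ?thesis by simp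
qed

end

section \<open>The stopping index\<close>

context trapezoidal_orbit
begin

text \<open>If P_k tends to \<beta>(y), the lines \<open>r1\<close>, \<open>r2\<close>,
  \<open>r3\<close> tend to the chord between \<beta>(x0) and \<beta>(y) and to the tangents at y
  and x0, which bound a nondegenerate triangle, possibly an unbounded one. The area of P_1 P_2 P_3
  tends to 0. The form without denominators also covers parallel tangents.\<close>

lemma no_stop_far:
  assumes "0 < \<delta>"
  shows "\<forall>\<^sub>F n in sequentially. \<forall>k. 4 \<le> k \<and> k \<le> 2 * n \<and> x0 + \<delta> \<le> p n k \<and> p n k \<le> x0 + L - \<delta>
    \<longrightarrow> \<not> stopping_condition (P n) k"
proof -
  have "\<forall>\<^sub>F n in sequentially. \<forall>k. N \<le> n \<and> 4 \<le> k \<and> k \<le> 2 * n \<and> x0 + \<delta> \<le> p n k \<and> p n k \<le> x0 + L - \<delta>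
    \<longrightarrow> \<not> stopping_condition (P n) k"
  proof (rule eventually_sequentially_by_subsequences[where f = p])
    fix r k y
    assume r: "strict_mono (r :: nat \<Rightarrow> nat)"
      and S: "\<And>i. N \<le> r i \<and> 4 \<le> k i \<and> k i \<le> 2 * r i \<and> x0 + \<delta> \<le> p (r i) (k i) \<and> p (r i) (k i) \<le> x0 + L - \<delta>"
      and y: "(\<lambda>i. p (r i) (k i)) \<longlonglongrightarrow> y" "x0 + \<delta> \<le> y" "y \<le> x0 + L - \<delta>"
    have "\<beta> y \<noteq> \<beta> x0" using injective_near[of y x0] y assms by (auto simp: abs_if)
    then have c: "0 < bracket (\<beta>' x0) (\<beta> y - \<beta> x0)" "0 < bracket (\<beta>' y) (\<beta> x0 - \<beta> y)"
      using support by metis+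
    define h where "h i = L / r i" for i
    have h: "h \<longlonglongrightarrow> 0" "\<And>i. 0 < h i"
    proof -
      show "h \<longlonglongrightarrow> 0" unfolding h_def by (rule lim_const_over_subseq[OF r])
      fix i
      have "0 < r i" using S[of i] N by linarith
      then show "0 < h i" using L_pos by (simp add: h_def)
    qed
    define q where "q j i = p (r i) (k i - j)" for j i
    have g: "(\<lambda>i. (q j i - q (Suc j) i) / h i) \<longlonglongrightarrow> 1" if "j \<le> 1" for j
    proof -
      have "1 \<le> k i - Suc j" "k i - Suc j < 2 * r i" for i using S[of i] that by linarith+
      moreover have "Suc (k i - Suc j) = k i - j" for i using S[of i] that by linarith
      ultimately show ?thesis
        using gap_scaled_tendsto[OF r, of "\<lambda>i. k i - Suc j"] S by (simp add: q_def h_def)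
    qed
    have q_step: "q (Suc j) \<longlonglongrightarrow> y" if "j \<le> 1" "q j \<longlonglongrightarrow> y" for j
    proof -
      have "(\<lambda>i. q j i - h i * ((q j i - q (Suc j) i) / h i)) \<longlonglongrightarrow> y - 0 * 1"
        by (intro tendsto_intros that g h)
      moreover have "q j i - h i * ((q j i - q (Suc j) i) / h i) = q (Suc j) i" for i
        using h(2)[of i] by simp
      ultimately show ?thesis by simp
    qed
    have q0: "q 0 \<longlonglongrightarrow> y" using y(1) by (simp add: q_def[abs_def])
    have q1: "q 1 \<longlonglongrightarrow> y" using q_step[OF _ q0] by simp
    have q2: "q 2 \<longlonglongrightarrow> y" using q_step[OF _ q1] by (simp add: numeral_2_eq_2)
    have P: "P (r i) 1 = \<beta> x0" "P (r i) 2 = \<beta> (x0 + h i)" "P (r i) 3 = \<beta> (x0 + 2 * h i)"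
        "P (r i) (k i) = \<beta> (q 0 i)" "P (r i) (k i - 1) = \<beta> (q 1 i)" "P (r i) (k i - 2) = \<beta> (q 2 i)" for i
    proof -
      have *: "N \<le> r i" "4 \<le> k i" "k i \<le> 2 * r i" using S[of i] by blast+
      have **: "P (r i) j = \<beta> (p (r i) j)" if "1 \<le> j" "j \<le> k i" for j
        using that * by (intro P_eq) auto
      show "P (r i) 1 = \<beta> x0" "P (r i) 2 = \<beta> (x0 + h i)" "P (r i) 3 = \<beta> (x0 + 2 * h i)"
        "P (r i) (k i) = \<beta> (q 0 i)" "P (r i) (k i - 1) = \<beta> (q 1 i)" "P (r i) (k i - 2) = \<beta> (q 2 i)"
        using **[of 1] **[of 2] **[of 3] **[of "k i"] **[of "k i - 1"] **[of "k i - 2"] *(2) p_init[OF *(1)]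
        by (simp_all add: h_def q_def)
    qed
    define U V W d where "U i = (1 / h i) *\<^sub>R (P (r i) 2 - P (r i) 1)" and "V i = (1 / h i) *\<^sub>R (P (r i) 3 - P (r i) 1)"
      and "W i = (1 / h i) *\<^sub>R (P (r i) (k i) - P (r i) (k i - 1))" and "d i = P (r i) (k i) - P (r i) 1" for i
    have h1: "(\<lambda>i. (x0 + h i - x0) / h i) \<longlonglongrightarrow> 1" and h2: "(\<lambda>i. (x0 + 2 * h i - x0) / h i) \<longlonglongrightarrow> 2"
      using h(2) by (simp_all add: less_imp_neq[symmetric])
    have x1: "(\<lambda>i. x0 + h i) \<longlonglongrightarrow> x0" and x2: "(\<lambda>i. x0 + 2 * h i) \<longlonglongrightarrow> x0"
      using tendsto_add[OF tendsto_const h(1), of x0] tendsto_add[OF tendsto_const tendsto_mult[OF tendsto_const h(1)], of x0 2]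
      by simp_all
    have U: "U \<longlonglongrightarrow> \<beta>' x0"
      using chord_tendsto[OF tendsto_const x1 h1] unfolding U_def P by simp
    have V: "V \<longlonglongrightarrow> 2 *\<^sub>R \<beta>' x0"
      using chord_tendsto[OF tendsto_const x2 h2] unfolding V_def P by simp
    have W: "W \<longlonglongrightarrow> \<beta>' y"
      using chord_tendsto[OF q1 q0, of h 1] g[of 0] unfolding W_def P by simp
    have d: "d \<longlonglongrightarrow> \<beta> y - \<beta> x0"
      unfolding d_def P by (intro tendsto_intros \<beta>_tendsto q0)
    \<comment> \<open>The coordinate of A on \<open>r3\<close> in the unit \<open>u\<close>, as
      forced by its position on \<open>r1\<close>. It tends to -2, and since \<open>u\<close>
      shrinks, A tends to P_1.\<close>
    define s where "s i = - bracket (V i) (d i) / bracket (U i) (d i)" for i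
    define A where "A i = P (r i) 3 + (h i * s i) *\<^sub>R U i" for i
    have Ud: "(\<lambda>i. bracket (U i) (d i)) \<longlonglongrightarrow> bracket (\<beta>' x0) (\<beta> y - \<beta> x0)"
      by (intro bracket.tendsto U d)
    have "s \<longlonglongrightarrow> - bracket (2 *\<^sub>R \<beta>' x0) (\<beta> y - \<beta> x0) / bracket (\<beta>' x0) (\<beta> y - \<beta> x0)"
      unfolding s_def using c by (intro tendsto_intros bracket.tendsto U V d) auto
    then have s: "s \<longlonglongrightarrow> -2" using c by (simp add: bracket.scaleR_left)
    have "A \<longlonglongrightarrow> \<beta> x0 + (0 * (-2)) *\<^sub>R \<beta>' x0"
      unfolding A_def P by (intro tendsto_intros \<beta>_tendsto x2 h s U)
    then have A: "A \<longlonglongrightarrow> \<beta> x0" by simp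
    define lhs rhs where "lhs i = (bracket (A i - P (r i) (k i - 2)) (W i))\<^sup>2 * \<bar>bracket (U i) (d i)\<bar>"
      and "rhs i = 4 * \<bar>bracket (U i) (V i)\<bar> * \<bar>bracket (W i) (d i)\<bar> * \<bar>bracket (U i) (W i)\<bar>" for i
    have lhs: "lhs \<longlonglongrightarrow> (bracket (\<beta> x0 - \<beta> y) (\<beta>' y))\<^sup>2 * \<bar>bracket (\<beta>' x0) (\<beta> y - \<beta> x0)\<bar>"
      unfolding lhs_def P by (intro tendsto_intros bracket.tendsto A U W d \<beta>_tendsto q2)
    have "(\<lambda>i. h i * rhs i) \<longlonglongrightarrow> 0 * (4 * \<bar>bracket (\<beta>' x0) (2 *\<^sub>R \<beta>' x0)\<bar> * \<bar>bracket (\<beta>' y) (\<beta> y - \<beta> x0)\<bar> * \<bar>bracket (\<beta>' x0) (\<beta>' y)\<bar>)"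
      unfolding rhs_def by (intro tendsto_intros bracket.tendsto U V W d h)
    then have rhs: "(\<lambda>i. h i * (h i * rhs i)) \<longlonglongrightarrow> 0" using tendsto_mult[OF h(1)] by fastforce
    obtain \<delta>' where \<delta>': "0 < \<delta>'"
      "\<And>a b c d. a < b \<Longrightarrow> b \<le> c \<Longrightarrow> c < d \<Longrightarrow> d < a + \<delta>' \<Longrightarrow> 0 < bracket (\<beta> b - \<beta> a) (\<beta> d - \<beta> c)"
      using bracket_chords_pos by blast
    show "\<exists>i. \<not> stopping_condition (P (r i)) (k i)"
    proof (rule ccontr)
      assume "\<not> ?thesis"
      then have stop: "\<And>i. stopping_condition (P (r i)) (k i)" by blast
      have "\<beta>' y \<noteq> 0" using c by auto
      then have "\<forall>\<^sub>F i in sequentially. W i \<noteq> 0" by (rule tendsto_imp_eventually_ne[OF W])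
      moreover have "\<forall>\<^sub>F i in sequentially. 0 < bracket (U i) (d i)"
        using Ud c(1) by (rule order_tendstoD(1))
      moreover have "\<forall>\<^sub>F i in sequentially. x0 + 2 * h i < x0 + \<delta>'"
        using x2 by (rule order_tendstoD(2)) (use \<delta>' in simp)
      ultimately have "\<forall>\<^sub>F i in sequentially. lhs i \<le> h i * (h i * rhs i)"
      proof eventually_elim
        case (elim i)
        note hi = h(2)[of i]
        define u w where "u = P (r i) 2 - P (r i) 1" and "w = P (r i) (k i) - P (r i) (k i - 1)"
        have scale: "u = h i *\<^sub>R U i" "w = h i *\<^sub>R W i" "P (r i) 3 - P (r i) 1 = h i *\<^sub>R V i"
          using hi by (simp_all add: u_def w_def U_def V_def W_def)
        have "0 < bracket (\<beta> (x0 + h i) - \<beta> x0) (\<beta> (x0 + 2 * h i) - \<beta> (x0 + h i))"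
          using hi elim(3) by (intro \<delta>'(2)) auto
        then have "0 < bracket (P (r i) 2 - P (r i) 1) (P (r i) 3 - P (r i) 2)" by (simp only: P)
        also have "\<dots> = bracket u (P (r i) 3 - P (r i) 1)"
          by (simp add: u_def bracket_eq algebra_simps)
        finally have u3: "bracket u (P (r i) 3 - P (r i) 1) \<noteq> 0" by simp
        have ud: "bracket u (d i) = h i * bracket (U i) (d i)" by (simp add: scale bracket.scaleR_left)
        then have nz: "bracket u (d i) \<noteq> 0" "w \<noteq> 0" using elim hi by (auto simp: scale)
        obtain t \<theta> where t: "\<theta> * t * bracket u (d i) = bracket (P (r i) 1 - P (r i) 3) (d i)"
          "(bracket (P (r i) 3 + (\<theta> * t) *\<^sub>R u - P (r i) (k i - 2)) w)\<^sup>2 * \<bar>bracket u (d i)\<bar>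
           \<le> 4 * \<bar>bracket u (P (r i) 3 - P (r i) 1)\<bar> * \<bar>bracket w (d i)\<bar> * \<bar>bracket u w\<bar>"
          using stopping_conditionD[OF stop[of i], of thesis] u3 nz unfolding u_def w_def d_def by blast
        have "P (r i) 1 - P (r i) 3 = - (h i *\<^sub>R V i)" by (simp flip: scale)
        then have "h i * (\<theta> * t * bracket (U i) (d i)) = h i * (- bracket (V i) (d i))"
          using t(1) by (simp add: ud bracket.minus_left bracket.scaleR_left mult_ac)
        then have "\<theta> * t * bracket (U i) (d i) = - bracket (V i) (d i)"
          unfolding mult_cancel_left using hi by simp
        then have "\<theta> * t = s i" using elim(2) by (simp add: s_def field_simps)
        then have "P (r i) 3 + (\<theta> * t) *\<^sub>R u = A i" by (simp add: A_def scale mult.commute)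
        with t(2) have "(bracket (A i - P (r i) (k i - 2)) (h i *\<^sub>R W i))\<^sup>2 * \<bar>bracket (h i *\<^sub>R U i) (d i)\<bar>
           \<le> 4 * \<bar>bracket (h i *\<^sub>R U i) (h i *\<^sub>R V i)\<bar> * \<bar>bracket (h i *\<^sub>R W i) (d i)\<bar> * \<bar>bracket (h i *\<^sub>R U i) (h i *\<^sub>R W i)\<bar>"
          by (simp only: scale)
        \<comment> \<open>Three short vectors occur on the left and five on the right; the surplus
          h^2 makes the right-hand side vanish in the limit.\<close>
        then have "h i ^ 3 * lhs i \<le> h i ^ 3 * (h i * (h i * rhs i))"
          using hi by (simp add: lhs_def rhs_def bracket.scaleR_left bracket.scaleR_right power_mult_distrib
              abs_mult power2_eq_square power3_eq_cube mult_ac)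
        then show ?case using hi by simp
      qed
      then have "(bracket (\<beta> x0 - \<beta> y) (\<beta>' y))\<^sup>2 * \<bar>bracket (\<beta>' x0) (\<beta> y - \<beta> x0)\<bar> \<le> 0"
        using tendsto_le[OF _ rhs lhs] by simp
      moreover have "bracket (\<beta> x0 - \<beta> y) (\<beta>' y) \<noteq> 0"
        using c(2) bracket_commute[of "\<beta> x0 - \<beta> y" "\<beta>' y"] by simp
      ultimately show False using c(1) by (simp add: mult_le_0_iff)
    qed
  qed blast
  then show ?thesis using eventually_ge_at_top[of N] by eventually_elim blast
qed

text \<open>In the limit A and B have the coordinates -2 (z - 2) / (z - 1) and (z - 4) / 2. With v =
  1 - z and X = v^2 - v - 4 their difference is X / (2 v), and the ratio of the areas is X^2 / (4
  v). The conditions X > 0 and X^2 < 16 v hold exactly for z between -3 and (1 - sqrt 17) / 2; the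
  interval of the statement is a compact piece of this range, of length 1.1.\<close>

lemma stops_at_return:
  "\<forall>\<^sub>F n in sequentially. \<forall>k. 4 \<le> k \<and> k \<le> 2 * n \<and>
      x0 + L - 14 / 5 * (L / n) \<le> p n k \<and> p n k \<le> x0 + L - 17 / 10 * (L / n) \<longrightarrow> stopping_condition (P n) k"
proof -
  have "\<forall>\<^sub>F n in sequentially. \<forall>k. N \<le> n \<and> 4 \<le> k \<and> k \<le> 2 * n \<and>
      x0 + L - 14 / 5 * (L / n) \<le> p n k \<and> p n k \<le> x0 + L - 17 / 10 * (L / n) \<longrightarrow> stopping_condition (P n) k"
  proof (rule eventually_sequentially_by_subsequences[where f = "\<lambda>n k. (p n k - x0 - L) / (L / n)"
        and lo = "- 14 / 5" and hi = "- 17 / 10"])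
    fix n k
    assume S: "N \<le> n \<and> 4 \<le> k \<and> k \<le> 2 * n \<and>
      x0 + L - 14 / 5 * (L / n) \<le> p n k \<and> p n k \<le> x0 + L - 17 / 10 * (L / n)"
    define h where "h = L / n"
    have h: "0 < h" using S N L_pos by (simp add: h_def)
    show "- 14 / 5 \<le> (p n k - x0 - L) / (L / n) \<and> (p n k - x0 - L) / (L / n) \<le> - 17 / 10"
      using S h by (auto simp: pos_le_divide_eq pos_divide_le_eq simp flip: h_def)
  next
    fix r k z
    assume r: "strict_mono (r :: nat \<Rightarrow> nat)"
      and S: "\<And>i. N \<le> r i \<and> 4 \<le> k i \<and> k i \<le> 2 * r i \<and> x0 + L - 14 / 5 * (L / r i) \<le> p (r i) (k i)
        \<and> p (r i) (k i) \<le> x0 + L - 17 / 10 * (L / r i)"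
      and z: "(\<lambda>i. (p (r i) (k i) - x0 - L) / (L / r i)) \<longlonglongrightarrow> z" "- 14 / 5 \<le> z" "z \<le> - 17 / 10"
    define h where "h i = L / r i" for i
    have h: "h \<longlonglongrightarrow> 0" "\<And>i. 0 < h i"
    proof -
      show "h \<longlonglongrightarrow> 0" unfolding h_def by (rule lim_const_over_subseq[OF r])
      fix i
      have "0 < r i" using S[of i] N by linarith
      then show "0 < h i" using L_pos by (simp add: h_def)
    qed
    define q where "q j i = (p (r i) (k i - j) - x0 - L) / h i" for j i
    have q_step: "q (Suc j) \<longlonglongrightarrow> l - 1" if "j \<le> 1" "q j \<longlonglongrightarrow> l" for j l
    proof -
      have "1 \<le> k i - Suc j" "k i - Suc j < 2 * r i" for i using S[of i] that by linarith+
      moreover have "Suc (k i - Suc j) = k i - j" for i using S[of i] that by linarith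
      ultimately have "(\<lambda>i. (p (r i) (k i - j) - p (r i) (k i - Suc j)) / h i) \<longlonglongrightarrow> 1"
        using gap_scaled_tendsto[OF r, of "\<lambda>i. k i - Suc j"] S by (simp add: h_def)
      then have "(\<lambda>i. q j i - (p (r i) (k i - j) - p (r i) (k i - Suc j)) / h i) \<longlonglongrightarrow> l - 1"
        by (intro tendsto_intros that)
      moreover have "q j i - (p (r i) (k i - j) - p (r i) (k i - Suc j)) / h i = q (Suc j) i" for i
        by (simp add: q_def diff_divide_distrib)
      ultimately show ?thesis by simp
    qed
    have q0: "q 0 \<longlonglongrightarrow> z" using z(1) by (simp add: q_def[abs_def] h_def)
    have q1: "q 1 \<longlonglongrightarrow> z - 1" using q_step[OF _ q0] by simp
    have q2: "q 2 \<longlonglongrightarrow> z - 2" using q_step[OF _ q1] by (simp add: numeral_2_eq_2)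
    have P: "P (r i) 1 = \<beta> (x0 + h i * 0)" "P (r i) 2 = \<beta> (x0 + h i * 1)" "P (r i) 3 = \<beta> (x0 + h i * 2)"
        "P (r i) (k i) = \<beta> (x0 + h i * q 0 i)" "P (r i) (k i - 1) = \<beta> (x0 + h i * q 1 i)"
        "P (r i) (k i - 2) = \<beta> (x0 + h i * q 2 i)" for i
    proof -
      have *: "N \<le> r i" "4 \<le> k i" "k i \<le> 2 * r i" using S[of i] by blast+
      have **: "P (r i) j = \<beta> (p (r i) j)" if "1 \<le> j" "j \<le> k i" for j
        using that * by (intro P_eq) auto
      have ***: "P (r i) (k i - j) = \<beta> (x0 + h i * q j i)" if "j \<le> 2" for j
      proof -
        have "P (r i) (k i - j) = \<beta> (p (r i) (k i - j))" using that *(2) by (intro **) auto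
        \<comment> \<open>Moving back by one period brings the last points next to P_1, where a
          single blow-up contains all six points.\<close>
        also have "\<dots> = \<beta> ((x0 + h i * q j i) + L)" using h(2)[of i] by (simp add: q_def)
        finally show ?thesis by (simp only: periodic)
      qed
      show "P (r i) 1 = \<beta> (x0 + h i * 0)" "P (r i) 2 = \<beta> (x0 + h i * 1)" "P (r i) 3 = \<beta> (x0 + h i * 2)"
        "P (r i) (k i) = \<beta> (x0 + h i * q 0 i)" "P (r i) (k i - 1) = \<beta> (x0 + h i * q 1 i)"
        "P (r i) (k i - 2) = \<beta> (x0 + h i * q 2 i)"
        using **[of 1] **[of 2] **[of 3] ***[of 0] ***[of 1] ***[of 2] *(2) p_init[OF *(1)]
        by (simp_all add: h_def mult.commute)
    qed
    define u w d where "u i = P (r i) 2 - P (r i) 1" and "w i = P (r i) (k i) - P (r i) (k i - 1)"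
      and "d i = P (r i) (k i) - P (r i) 1" for i
    note lims = bracket_chords_tendsto[OF h, where x = x0]
    define e1 e2 e3 e0 f1 f2 where "e1 i = bracket (u i) (w i) / h i ^ 3" and "e2 i = bracket (u i) (d i) / h i ^ 3"
      and "e3 i = bracket (w i) (d i) / h i ^ 3" and "e0 i = bracket (u i) (P (r i) 3 - P (r i) 1) / h i ^ 3"
      and "f1 i = bracket (P (r i) 1 - P (r i) 3) (d i) / h i ^ 3"
      and "f2 i = bracket (P (r i) (k i - 2) - P (r i) 3) (w i) / h i ^ 3" for i
    have e1: "e1 \<longlonglongrightarrow> z - 1"
    proof -
      have eq: "(1 - 0) * (z - (z - 1)) * ((z - 1) + z - 0 - 1) / 2 = z - 1" by (simp add: field_simps)
      show ?thesis
        using lims[OF tendsto_const[of 0] tendsto_const[of 1] q1 q0] unfolding e1_def u_def w_def P eq .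
    qed
    have e2: "e2 \<longlonglongrightarrow> z * (z - 1) / 2"
    proof -
      have eq: "(1 - 0) * (z - 0) * (0 + z - 0 - 1) / 2 = z * (z - 1) / 2" by (simp add: field_simps)
      show ?thesis
        using lims[OF tendsto_const[of 0] tendsto_const[of 1] tendsto_const[of 0] q0] unfolding e2_def u_def d_def P eq .
    qed
    have e3: "e3 \<longlonglongrightarrow> z * (1 - z) / 2"
    proof -
      have eq: "(z - (z - 1)) * (z - 0) * (0 + z - (z - 1) - z) / 2 = z * (1 - z) / 2" by (simp add: field_simps)
      show ?thesis
        using lims[OF q1 q0 tendsto_const[of 0] q0] unfolding e3_def w_def d_def P eq .
    qed
    have e0: "e0 \<longlonglongrightarrow> 1"
    proof -
      have eq: "(1 - 0) * (2 - 0 :: real) * (0 + 2 - 0 - 1) / 2 = 1" by (simp add: field_simps)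
      show ?thesis
        using lims[OF tendsto_const[of 0] tendsto_const[of 1] tendsto_const[of 0] tendsto_const[of 2]] unfolding e0_def u_def P eq .
    qed
    have f1: "f1 \<longlonglongrightarrow> - z * (z - 2)"
    proof -
      have eq: "(0 - 2) * (z - 0) * (0 + z - 2 - 0) / 2 = - z * (z - 2)" by (simp add: field_simps)
      show ?thesis
        using lims[OF tendsto_const[of 2] tendsto_const[of 0] tendsto_const[of 0] q0] unfolding f1_def d_def P eq .
    qed
    have f2: "f2 \<longlonglongrightarrow> (z - 4) * (z - 1) / 2"
    proof -
      have eq: "((z - 2) - 2) * (z - (z - 1)) * ((z - 1) + z - 2 - (z - 2)) / 2 = (z - 4) * (z - 1) / 2" by (simp add: field_simps)
      show ?thesis
        using lims[OF tendsto_const[of 2] q2 q1 q0] unfolding f2_def w_def P eq .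
    qed
    have z0: "z < 0" "z - 1 < 0" "z - 2 < 0" using z by auto
    define s t where "s i = f1 i / e2 i" and "t i = f2 i / e1 i" for i
    have "s \<longlonglongrightarrow> (- z * (z - 2)) / (z * (z - 1) / 2)"
      unfolding s_def using z0 by (intro tendsto_intros f1 e2) auto
    moreover have "(- z * (z - 2)) / (z * (z - 1) / 2) = - 2 * (z - 2) / (z - 1)"
      using z0 by (simp add: field_simps)
    ultimately have s: "s \<longlonglongrightarrow> - 2 * (z - 2) / (z - 1)" by simp
    have "t \<longlonglongrightarrow> ((z - 4) * (z - 1) / 2) / (z - 1)"
      unfolding t_def using z0 by (intro tendsto_intros f2 e1) auto
    moreover have "((z - 4) * (z - 1) / 2) / (z - 1) = (z - 4) / 2" using z0 by (simp add: divide_simps)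
    ultimately have t: "t \<longlonglongrightarrow> (z - 4) / 2" by (simp only:)
    define v where "v = 1 - z"
    define X where "X = v\<^sup>2 - v - 4"
    have v: "27 / 10 \<le> v" "v \<le> 19 / 5" "z = 1 - v" using z by (auto simp: v_def)
    have st: "- 2 * (z - 2) / (z - 1) - (z - 4) / 2 = X / (2 * v)"
      using v(1) unfolding v(3) by (simp add: X_def field_simps power2_eq_square)
    \<comment> \<open>Linear bounds for v (v - 1) on 2.7 \<le> v \<le> 3.8: there v - 1 is at most
      14/5, and 6.64 = 14/5 * 19/5 - 4.\<close>
    have X: "0 < X" "X \<le> 14 / 5 * v - 4" "X \<le> 664 / 100"
    proof -
      define Y where "Y = v * (v - 1)"
      have XY: "X = Y - 4" by (simp add: X_def Y_def power2_eq_square algebra_simps)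
      have "27 / 10 * (v - 1) \<le> Y" unfolding Y_def using v by (intro mult_right_mono) auto
      then show "0 < X" using XY v by simp
      have "Y \<le> v * (14 / 5)" unfolding Y_def using v by (intro mult_left_mono) auto
      then show "X \<le> 14 / 5 * v - 4" using XY by simp
      then show "X \<le> 664 / 100" using v by simp
    qed
    have "X\<^sup>2 < 16 * v"
    proof -
      have "X\<^sup>2 \<le> 664 / 100 * X" using X by (simp add: power2_eq_square mult_right_mono)
      also have "\<dots> \<le> 664 / 100 * (14 / 5 * v - 4)" using X by simp
      also have "\<dots> < 16 * v" using v by simp
      finally show ?thesis .
    qed
    then have "X\<^sup>2 / (4 * v) < 4" using v by (simp add: field_simps)
    moreover have "(X / (2 * v))\<^sup>2 * v = X\<^sup>2 / (4 * v)"
      using v by (simp add: power2_eq_square field_simps)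
    ultimately have lt: "(X / (2 * v))\<^sup>2 * \<bar>z * (z - 1) / 2\<bar> * \<bar>z - 1\<bar> / \<bar>z * (1 - z) / 2\<bar> < 4 * \<bar>1\<bar>"
      using v z0 by (simp add: abs_mult)
    have "(\<lambda>i. (s i - t i)\<^sup>2 * \<bar>e2 i\<bar> * \<bar>e1 i\<bar> / \<bar>e3 i\<bar> - 4 * \<bar>e0 i\<bar>) \<longlonglongrightarrow>
       (X / (2 * v))\<^sup>2 * \<bar>z * (z - 1) / 2\<bar> * \<bar>z - 1\<bar> / \<bar>z * (1 - z) / 2\<bar> - 4 * \<bar>1\<bar>"
      unfolding st[symmetric] using z0 by (intro tendsto_intros s t e2 e1 e3 e0) auto
    then have 1: "\<forall>\<^sub>F i in sequentially. (s i - t i)\<^sup>2 * \<bar>e2 i\<bar> * \<bar>e1 i\<bar> / \<bar>e3 i\<bar> - 4 * \<bar>e0 i\<bar> < 0"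
      using lt by (intro order_tendstoD(2)) auto
    have "(\<lambda>i. s i - t i) \<longlonglongrightarrow> X / (2 * v)"
      unfolding st[symmetric] by (intro tendsto_intros s t)
    then have 2: "\<forall>\<^sub>F i in sequentially. 0 < s i - t i"
      by (rule order_tendstoD(1)) (use X v in simp)
    have 3: "\<forall>\<^sub>F i in sequentially. s i < 0"
      using z0 by (intro order_tendstoD(2)[OF s]) (simp add: divide_less_0_iff)
    have 4: "\<forall>\<^sub>F i in sequentially. e1 i \<noteq> 0" "\<forall>\<^sub>F i in sequentially. e2 i \<noteq> 0" "\<forall>\<^sub>F i in sequentially. e3 i \<noteq> 0"
      using z0 by (intro tendsto_imp_eventually_ne[OF e1] tendsto_imp_eventually_ne[OF e2] tendsto_imp_eventually_ne[OF e3]; simp)+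
    have "\<forall>\<^sub>F i in sequentially. stopping_condition (P (r i)) (k i)"
      using 1 2 3 4
    proof eventually_elim
      case (elim i)
      \<comment> \<open>All determinants have the same scale \<open>H\<close>: the coordinates of A
        and B do not depend on it, and the two areas are proportional to it.\<close>
      define H where "H = h i ^ 3"
      have H: "0 < H" using h(2) by (simp add: H_def)
      have unscale: "bracket (u i) (w i) = H * e1 i" "bracket (u i) (d i) = H * e2 i" "bracket (w i) (d i) = H * e3 i"
        "bracket (u i) (P (r i) 3 - P (r i) 1) = H * e0 i" "bracket (P (r i) 1 - P (r i) 3) (d i) = H * f1 i"
        "bracket (P (r i) (k i - 2) - P (r i) 3) (w i) = H * f2 i"
        using H by (simp_all add: e1_def e2_def e3_def e0_def f1_def f2_def flip: H_def)
      have st: "bracket (P (r i) 1 - P (r i) 3) (d i) / bracket (u i) (d i) = s i"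
        "bracket (P (r i) (k i - 2) - P (r i) 3) (w i) / bracket (u i) (w i) = t i"
        unfolding unscale s_def t_def using H by simp_all
      have "H * ((s i - t i)\<^sup>2 * \<bar>e2 i\<bar> * \<bar>e1 i\<bar> / \<bar>e3 i\<bar>) < H * (4 * \<bar>e0 i\<bar>)"
        using elim H by (intro mult_strict_left_mono) auto
      moreover have "(s i - t i)\<^sup>2 * \<bar>H * e2 i\<bar> * \<bar>H * e1 i\<bar> / \<bar>H * e3 i\<bar>
          = H * ((s i - t i)\<^sup>2 * \<bar>e2 i\<bar> * \<bar>e1 i\<bar> / \<bar>e3 i\<bar>)"
        "4 * \<bar>H * e0 i\<bar> = H * (4 * \<bar>e0 i\<bar>)"
        using H by (simp_all add: abs_mult)
      ultimately have area: "(s i - t i)\<^sup>2 * \<bar>bracket (u i) (d i)\<bar> * \<bar>bracket (u i) (w i)\<bar> / \<bar>bracket (w i) (d i)\<bar>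
          < 4 * \<bar>bracket (u i) (P (r i) 3 - P (r i) 1)\<bar>"
        by (simp only: unscale)
      have nz: "bracket (u i) (d i) \<noteq> 0" "bracket (w i) (d i) \<noteq> 0" "bracket (u i) (w i) \<noteq> 0"
        unfolding unscale using elim H by simp_all
      show ?case
        using stopping_conditionI[of "P (r i)" "k i"] nz area elim st
        unfolding u_def w_def d_def by simp
    qed
    then show "\<exists>i. stopping_condition (P (r i)) (k i)"
      by (rule eventually_happens'[rotated]) simp
  qed
  then show ?thesis using eventually_ge_at_top[of N] by eventually_elim blast
qed

text \<open>The window of \<open>stops_at_return\<close> has the length 11/10 h, and the gaps
  eventually stay below that, so the sequence cannot jump over it. The drift bound converts the
  position into a bound for the index.\<close>

lemma eventually_stops:
  "\<forall>\<^sub>F n in sequentially. \<exists>k. 4 \<le> k \<and> k \<le> 2 * n \<and> real k \<le> n + (1 + E / L) \<and> stopping_condition (P n) k"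
proof -
  have "\<forall>\<^sub>F n in sequentially. E / L / real n < 1 / 10"
    using lim_const_over_n by (rule order_tendstoD(2)) simp
  then show ?thesis
    using stops_at_return eventually_increasing eventually_ge_at_top[of N] eventually_ge_at_top[of 8]
  proof eventually_elim
    case (elim n)
    define h where "h = L / real n"
    have n: "8 \<le> real n" using elim by simp
    have h: "0 < h" "real n * h = L" using n L_pos by (simp_all add: h_def)
    have En: "E / real n \<le> real n / 10 * h" "E / (real n)\<^sup>2 < h / 10"
      using elim(1) n L_pos by (simp_all add: h_def field_simps power2_eq_square)
    \<comment> \<open>\<open>k\<close> is the first index that reaches the lower end of the window;
      index \<open>2 * n\<close> certainly does, being almost a second turn ahead.\<close>
    define A where "A j \<longleftrightarrow> 1 \<le> j \<and> j \<le> 2 * n \<and> x0 + L - 14 / 5 * h \<le> p n j" for j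
    define k where "k = (LEAST j. A j)"
    have "A (2 * n)"
    proof -
      have "\<bar>p n (2 * n) - x0 - (real (2 * n) - 1) * h\<bar> \<le> E / real n"
        using drift[OF elim(4), of "2 * n"] n by (simp add: h_def)
      moreover have "real n / 10 * h + L - 14 / 5 * h \<le> (real (2 * n) - 1) * h"
      proof -
        have "(real n / 10 + real n - 14 / 5) * h \<le> (real (2 * n) - 1) * h"
          using n h by (intro mult_right_mono) auto
        then show ?thesis by (simp add: algebra_simps flip: h(2))
      qed
      ultimately show ?thesis using En n unfolding A_def by linarith
    qed
    then have k: "A k" unfolding k_def by (rule LeastI)
    \<comment> \<open>The initial points are no farther than 2 h, and 2 h + 14/5 h is less than 8 h
      \<le> L.\<close>
    have "\<not> A j" if "j \<le> 3" for j
    proof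
      assume j: "A j"
      then have "p n j \<le> p n 3"
        using elim(3) n that by (cases "j = 3") (auto simp: A_def intro!: less_imp_le)
      also have "\<dots> = x0 + 2 * h" using p_init(3)[OF elim(4)] by (simp add: h_def)
      finally have "L - 14 / 5 * h \<le> 2 * h" using j unfolding A_def by linarith
      moreover have "8 * h \<le> L" unfolding h(2)[symmetric] using n h by (intro mult_right_mono) auto
      ultimately show False using h by linarith
    qed
    then have "\<not> k \<le> 3" using k by blast
    then have k4: "4 \<le> k" by simp
    have k2: "k \<le> 2 * n" using k by (simp add: A_def)
    have "\<not> A (k - 1)" unfolding k_def by (rule not_less_Least) (use k4 in \<open>simp add: k_def\<close>)
    then have "p n (k - 1) < x0 + L - 14 / 5 * h" using k4 k2 by (auto simp: A_def)
    moreover have "\<bar>p n k - p n (k - 1) - h\<bar> \<le> E / (real n)\<^sup>2"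
      using gap[OF elim(4), of "k - 1"] k4 k2 by (simp add: h_def)
    \<comment> \<open>The predecessor lies before the window, and 14/5 - 11/10 = 17/10.\<close>
    ultimately have up: "p n k \<le> x0 + L - 17 / 10 * h" using En(2) by linarith
    then have stop: "stopping_condition (P n) k"
      using elim(2) k4 k2 k by (simp add: A_def h_def)
    have "\<bar>p n k - x0 - (real k - 1) * h\<bar> \<le> E / real n"
      using drift[OF elim(4), of k] k4 k2 by (simp add: h_def)
    then have "(real k - 1) * h \<le> real n * h + E / real n"
      using up h by (simp add: abs_le_iff)
    also have "\<dots> = (real n + E / L) * h" using n L_pos by (simp add: h_def field_simps)
    finally have "real k - 1 \<le> real n + E / L" using h by (simp add: mult_le_cancel_right_pos)
    then show ?case using k4 k2 stop by (intro exI[of _ k]) auto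
  qed
qed

text \<open>The stopping point cannot lie before \<open>x0 + L - \<eta>\<close>, which bounds the
  index from below, and \<open>eventually_stops\<close> bounds it from above.\<close>

lemma stopping_index_asymptotics: "(\<lambda>n. real (stopping_index (P n)) / real n) \<longlonglongrightarrow> 1"
proof (rule tendstoI)
  fix \<epsilon> :: real assume \<epsilon>: "0 < \<epsilon>"
  obtain \<delta> where \<delta>: "0 < \<delta>"
    "\<forall>\<^sub>F n in sequentially. \<forall>k. 4 \<le> k \<and> k \<le> 2 * n \<and> p n k \<le> x0 + \<delta> \<longrightarrow> \<not> stopping_condition (P n) k"
    using no_stop_near_start by blast
  \<comment> \<open>As \<eta> \<le> \<delta>, the excluded positions up to
    \<open>x0 + \<delta>\<close> and from \<open>x0 + \<eta>\<close> to
    \<open>x0 + L - \<eta>\<close> leave no hole. The remaining arc costs at most \<epsilon> / 2 in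
    the ratio.\<close>
  define \<eta> where "\<eta> = min \<delta> (\<epsilon> * L / 2)"
  have \<eta>: "0 < \<eta>" "\<eta> \<le> \<delta>" "\<eta> \<le> \<epsilon> * L / 2" using \<delta>(1) \<epsilon> L_pos by (auto simp: \<eta>_def)
  have 1: "\<forall>\<^sub>F n in sequentially. (1 + E / L) / real n < 1" "\<forall>\<^sub>F n in sequentially. (1 + E / L) / real n < \<epsilon> / 2"
    using \<epsilon> by (intro order_tendstoD(2)[OF lim_const_over_n]; simp)+
  show "\<forall>\<^sub>F n in sequentially. dist (real (stopping_index (P n)) / real n) 1 < \<epsilon>"
    using 1 \<delta>(2) no_stop_far[OF \<eta>(1)] eventually_stops eventually_ge_at_top[of N]
  proof eventually_elim
    case (elim n)
    have n: "0 < real n" using elim N by simp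
    obtain k where k: "4 \<le> k" "k \<le> 2 * n" "real k \<le> real n + (1 + E / L)" "stopping_condition (P n) k"
      using elim(5) by blast
    define m where "m = stopping_index (P n)"
    have m: "4 \<le> m" "stopping_condition (P n) m"
      using LeastI[of "\<lambda>k. 4 \<le> k \<and> stopping_condition (P n) k" k] k
      by (auto simp: m_def stopping_index_def)
    have mk: "m \<le> k"
      using Least_le[of "\<lambda>k. 4 \<le> k \<and> stopping_condition (P n) k" k] k
      by (auto simp: m_def stopping_index_def)
    then have m2: "m \<le> 2 * n" using k by simp
    have "x0 + \<delta> < p n m" using elim(3) m m2 by force
    then have "x0 + L - \<eta> < p n m" using elim(4) m m2 \<eta>(2) by force
    moreover have "\<bar>p n m - x0 - (real m - 1) * (L / n)\<bar> \<le> E / n"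
      using drift[OF elim(6)] m m2 by simp
    ultimately have "L - \<epsilon> * L / 2 - E / n < (real m - 1) * (L / n)"
      using \<eta>(3) unfolding abs_le_iff by linarith
    also have "\<dots> \<le> real m * (L / n)" using n L_pos by (intro mult_right_mono) auto
    finally have "(L - \<epsilon> * L / 2 - E / n) / L < real m * (L / n) / L"
      using L_pos by (intro divide_strict_right_mono)
    moreover have "(L - \<epsilon> * L / 2 - E / n) / L = 1 - \<epsilon> / 2 - E / L / n"
      using L_pos n by (simp add: field_simps)
    moreover have "real m * (L / n) / L = real m / n" using L_pos by simp
    moreover have "E / L / n \<le> (1 + E / L) / n" using n by (intro divide_right_mono) auto
    ultimately have low: "1 - \<epsilon> < real m / n" using elim(2) by linarith
    have "real m / n \<le> (real n + (1 + E / L)) / n"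
      using mk k(3) n by (intro divide_right_mono) auto
    also have "\<dots> = 1 + (1 + E / L) / n" using n by (simp add: add_divide_distrib)
    finally have "real m / n < 1 + \<epsilon>" using elim(2) \<epsilon> by linarith
    with low show ?case by (simp add: dist_real_def abs_less_iff flip: m_def)
  qed
qed

end

section \<open>Strict convexity\<close>

lemma periodic_of_int:
  fixes f :: "real \<Rightarrow> 'a"
  assumes "\<And>t. f (t + T) = f t"
  shows "f (t + of_int j * T) = f t"
proof (induction j rule: int_induct[where k = 0])
  case (step1 i)
  have "f (t + of_int (i + 1) * T) = f ((t + of_int i * T) + T)" by (simp add: algebra_simps)
  then show ?case using step1 by (simp add: assms)
next
  case (step2 i)
  have "f (t + of_int i * T) = f ((t + of_int (i - 1) * T) + T)" by (simp add: algebra_simps)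
  then show ?case using step2 by (simp add: assms)
qed simp

lemma reduce_mod_period:
  fixes t T :: real
  assumes "0 < T"
  obtains s j where "t = s + of_int j * T" "0 \<le> s" "s < T"
proof
  show "t = (t - of_int \<lfloor>t / T\<rfloor> * T) + of_int \<lfloor>t / T\<rfloor> * T" by simp
  have "of_int \<lfloor>t / T\<rfloor> * T \<le> t" "t < (of_int \<lfloor>t / T\<rfloor> + 1) * T"
    using floor_correct[of "t / T"] assms by (metis pos_le_divide_eq, metis of_int_add of_int_1 pos_divide_less_eq)
  then show "0 \<le> t - of_int \<lfloor>t / T\<rfloor> * T" "t - of_int \<lfloor>t / T\<rfloor> * T < T"
    by (simp_all add: algebra_simps)
qed

lemma periodic_continuous_bounded:
  fixes f :: "real \<Rightarrow> 'a::real_normed_vector"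
  assumes T: "0 < T" and per: "\<And>t. f (t + T) = f t" and cont: "continuous_on UNIV f"
  obtains B where "0 < B" "\<And>t. norm (f t) \<le> B"
proof -
  have "compact (f ` {0..T})"
    by (intro compact_continuous_image continuous_on_subset[OF cont]) auto
  then obtain B where B: "0 < B" "\<And>x. x \<in> f ` {0..T} \<Longrightarrow> norm x \<le> B"
    using compact_imp_bounded bounded_pos by metis
  have "norm (f t) \<le> B" for t
  proof -
    obtain s j where "t = s + of_int j * T" "0 \<le> s" "s < T" by (rule reduce_mod_period[OF T])
    then show ?thesis using B(2)[of "f s"] periodic_of_int[of f, OF per] by simp
  qed
  with B(1) show ?thesis by (rule that)
qed

locale convex_curve =
  fixes \<gamma> :: "real \<Rightarrow> real^2" and T :: real
  assumes curve: "smooth_closed_convex_curve \<gamma> T"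
begin

definition g :: "nat \<Rightarrow> real \<Rightarrow> real^2" where "g k = (vderiv ^^ k) \<gamma>"

definition H :: "(real^2) set" where "H = convex hull (range \<gamma>)"

lemma T_pos: "0 < T"
  and g_0: "g 0 = \<gamma>" and g_1: "vderiv \<gamma> = g 1" and g_2: "vderiv (g 1) = g 2"
  and \<gamma>_periodic: "\<gamma> (t + T) = \<gamma> t"
  and \<gamma>_inj: "inj_on \<gamma> {0..<T}"
  and bracket_nonzero: "bracket (g 1 t) (g 2 t) \<noteq> 0"
  and frontier_H: "frontier H = range \<gamma>"
  and interior_left: "x \<in> interior H \<Longrightarrow> 0 < bracket (g 1 t) (x - \<gamma> t)"
  using curve by (auto simp: smooth_closed_convex_curve_def g_def H_def numeral_2_eq_2)

lemma \<gamma>_in_H: "\<gamma> t \<in> H"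
  unfolding H_def by (rule hull_inc) simp

lemma g_deriv: "(g k has_vector_derivative g (Suc k) t) (at t)"
proof -
  have "g k differentiable (at t)"
    using curve by (simp add: smooth_closed_convex_curve_def smooth_curve_def g_def differentiable_on_def)
  then show ?thesis by (simp add: g_def vderiv_def vector_derivative_works)
qed

lemma \<gamma>_deriv: "(\<gamma> has_vector_derivative g 1 t) (at t)"
  using g_deriv[of 0] by (simp add: g_0)

lemma g_cont: "continuous_on UNIV (g k)"
  using g_deriv has_vector_derivative_continuous continuous_at_imp_continuous_on by metis

lemma g_periodic: "g k (t + T) = g k t"
proof (induction k arbitrary: t)
  case 0
  then show ?case by (simp add: g_0 \<gamma>_periodic)
next
  case (Suc k)
  have "((\<lambda>x. x + T) has_vector_derivative 1) (at t)"
    by (auto intro!: derivative_eq_intros)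
  then have "(g k \<circ> (\<lambda>x. x + T) has_vector_derivative 1 *\<^sub>R g (Suc k) (t + T)) (at t)"
    by (rule vector_diff_chain_at) (rule g_deriv)
  then have "(g k has_vector_derivative g (Suc k) (t + T)) (at t)"
    using Suc by (simp add: o_def)
  then show ?case using g_deriv by (rule vector_derivative_unique_at)
qed

text \<open>The orientation clause speaks of interior points and is empty if there are none. If the
  hull lay on a line with normal \<open>a\<close>, differentiating twice would make \<open>a\<close>
  orthogonal to the independent vectors \<gamma>' and \<gamma>''.\<close>

lemma interior_nonempty: "interior H \<noteq> {}"
proof
  assume "interior H = {}"
  then obtain a b where ab: "a \<noteq> 0" "H \<subseteq> {x. a \<bullet> x = b}"
    using empty_interior_subset_hyperplane[of H] by (auto simp: H_def)
  have inner: "a \<bullet> g 1 t = 0" "a \<bullet> g 2 t = 0" for t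
  proof -
    have "((\<lambda>t. a \<bullet> \<gamma> t) has_real_derivative a \<bullet> g 1 t) (at t)" for t
      using bounded_linear.has_vector_derivative[OF bounded_linear_inner_right \<gamma>_deriv]
      by (simp add: has_real_derivative_iff_has_vector_derivative)
    moreover have "a \<bullet> \<gamma> t = b" for t using ab(2) \<gamma>_in_H by blast
    ultimately have "((\<lambda>t. b) has_real_derivative a \<bullet> g 1 t) (at t)" for t by simp
    from DERIV_unique[OF this DERIV_const] have 1: "a \<bullet> g 1 t = 0" for t .
    have "((\<lambda>t. a \<bullet> g 1 t) has_real_derivative a \<bullet> g 2 t) (at t)"
      using bounded_linear.has_vector_derivative[OF bounded_linear_inner_right g_deriv[of 1]]
      by (simp add: has_real_derivative_iff_has_vector_derivative numeral_2_eq_2)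
    then have "((\<lambda>t. 0) has_real_derivative a \<bullet> g 2 t) (at t)" by (simp only: 1)
    from DERIV_unique[OF this DERIV_const] show "a \<bullet> g 2 t = 0" .
    show "a \<bullet> g 1 t = 0" by (rule 1)
  qed
  have "a $ 1 * bracket (g 1 0) (g 2 0) = (a \<bullet> g 1 0) * g 2 0 $ 2 - (a \<bullet> g 2 0) * g 1 0 $ 2"
    "a $ 2 * bracket (g 1 0) (g 2 0) = (a \<bullet> g 2 0) * g 1 0 $ 1 - (a \<bullet> g 1 0) * g 2 0 $ 1"
    by (simp_all add: bracket_eq inner_vec_def sum_2 algebra_simps)
  then have "a = 0" using inner bracket_nonzero[of 0] by (simp add: vec_eq_iff forall_2)
  with ab(1) show False by simp
qed

text \<open>The orientation clause extends by continuity to the closure of the interior, which for a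
  convex set with interior points is the closure of the set.\<close>

lemma support_weak: "0 \<le> bracket (g 1 t) (\<gamma> s - \<gamma> t)"
proof -
  have "closed {x. 0 \<le> bracket (g 1 t) (x - \<gamma> t)}"
    by (intro closed_Collect_le continuous_intros bracket.continuous_on)
  then have "closure (interior H) \<subseteq> {x. 0 \<le> bracket (g 1 t) (x - \<gamma> t)}"
    using interior_left[of _ t] by (intro closure_minimal) (auto intro: less_imp_le)
  moreover have "closure (interior H) = closure H"
    using interior_nonempty by (intro convex_closure_interior) (simp_all add: H_def)
  moreover have "\<gamma> s \<in> closure H"
    using closure_subset \<gamma>_in_H by blast
  ultimately show ?thesis by blast
qed

lemma tangent_height_deriv:
  "((\<lambda>t. bracket v (\<gamma> t - \<gamma> s)) has_real_derivative bracket v (g 1 t)) (at t)"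
  "((\<lambda>t. bracket v (g 1 t)) has_real_derivative bracket v (g 2 t)) (at t)"
  using bracket_has_real_derivative_right[OF \<gamma>_deriv] bracket_has_real_derivative_right[OF g_deriv[of 1]]
  by (auto simp: bracket.diff_right numeral_2_eq_2 intro!: derivative_eq_intros)

text \<open>The height of \<gamma> above its tangent at \<open>s\<close> vanishes there to first
  order and has the second derivative [\<gamma>', \<gamma>'']. A negative value would take the curve
  to the wrong side just after \<open>s\<close>.\<close>

lemma bracket_pos: "0 < bracket (g 1 s) (g 2 s)"
proof (rule ccontr)
  assume "\<not> ?thesis"
  then have neg: "bracket (g 1 s) (g 2 s) < 0" using bracket_nonzero[of s] by linarith
  define f where "f t = bracket (g 1 s) (\<gamma> t - \<gamma> s)" for t
  obtain d where d: "0 < d" "\<And>h. 0 < h \<Longrightarrow> h < d \<Longrightarrow> bracket (g 1 s) (g 1 (s + h)) < 0"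
    using DERIV_neg_dec_right[OF tangent_height_deriv(2) neg] by auto
  have "s < s + d / 2" using d by simp
  then obtain \<xi> where "s < \<xi>" "\<xi> < s + d / 2" "f (s + d / 2) - f s = (s + d / 2 - s) * bracket (g 1 s) (g 1 \<xi>)"
    unfolding f_def using MVT2[OF _ tangent_height_deriv(1)] by blast
  moreover from this have "bracket (g 1 s) (g 1 \<xi>) < 0" using d(2)[of "\<xi> - s"] d(1) by simp
  moreover have "f s = 0" by (simp add: f_def)
  moreover have "d / 2 * bracket (g 1 s) (g 1 \<xi>) < 0" using d(1) calculation by (intro mult_pos_neg) auto
  ultimately have "f (s + d / 2) < 0" by simp
  then show False using support_weak[of s "s + d / 2"] by (simp add: f_def)
qed

text \<open>The zeros of the height above a tangent line are nondegenerate minima, hence isolated, whereas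
  a second contact point would put a whole segment of the tangent line on the curve.\<close>

lemma support_strict:
  assumes "\<gamma> t \<noteq> \<gamma> s"
  shows "0 < bracket (g 1 s) (\<gamma> t - \<gamma> s)"
proof (rule ccontr)
  assume "\<not> ?thesis"
  then have t0: "bracket (g 1 s) (\<gamma> t - \<gamma> s) = 0" using support_weak[of s t] by linarith
  define f where "f t = bracket (g 1 s) (\<gamma> t - \<gamma> s)" for t
  have f_nonneg: "0 \<le> f t" for t using support_weak by (simp add: f_def)
  have f_deriv1: "(f has_real_derivative bracket (g 1 s) (g 1 t)) (at t)" for t
    using tangent_height_deriv(1) by (simp add: f_def[abs_def])
  have f_cont: "continuous_on UNIV f"
    using f_deriv1 by (intro continuous_at_imp_continuous_on) (auto intro: DERIV_isCont)
  have crit: "bracket (g 1 s) (g 1 z) = 0" "bracket (g 1 s) (g 2 z) \<noteq> 0" if "f z = 0" for z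
  proof -
    show 1: "bracket (g 1 s) (g 1 z) = 0"
      using f_deriv1 by (rule DERIV_local_min[of _ _ _ 1]) (use f_nonneg that in auto)
    have "g 1 s \<noteq> 0" "g 1 z \<noteq> 0" using bracket_nonzero[of s] bracket_nonzero[of z] by auto
    \<comment> \<open>The velocities at \<open>s\<close> and \<open>z\<close> are parallel, so
      nondegeneracy at \<open>z\<close> carries over.\<close>
    then obtain c where "g 1 s = c *\<^sub>R g 1 z" "c \<noteq> 0"
      using bracket_eq_0_imp_scaleR[OF 1] by (metis scaleR_eq_0_iff)
    then show "bracket (g 1 s) (g 2 z) \<noteq> 0"
      using bracket_nonzero[of z] by (simp add: bracket.scaleR_left)
  qed
  define Z where "Z = {z \<in> {0..T}. f z = 0}"
  have "closed_segment (\<gamma> s) (\<gamma> t) \<subseteq> \<gamma> ` Z"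
  proof
    fix x assume x: "x \<in> closed_segment (\<gamma> s) (\<gamma> t)"
    then obtain u where u: "x = (1 - u) *\<^sub>R \<gamma> s + u *\<^sub>R \<gamma> t" by (auto simp: in_segment)
    have "x - \<gamma> s = u *\<^sub>R (\<gamma> t - \<gamma> s)" by (simp add: u algebra_simps)
    then have x0: "bracket (g 1 s) (x - \<gamma> s) = 0" using t0 by (simp add: bracket.scaleR_right)
    have "x \<in> H" using x closed_segment_subset[OF \<gamma>_in_H \<gamma>_in_H] by (auto simp: H_def)
    moreover have "x \<notin> interior H" using interior_left[of x s] x0 by auto
    ultimately have "x \<in> frontier H" unfolding frontier_def using closure_subset by blast
    then obtain z where z: "x = \<gamma> z" using frontier_H by auto
    obtain z' j where "z = z' + of_int j * T" "0 \<le> z'" "z' < T" by (rule reduce_mod_period[OF T_pos])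
    then have "x = \<gamma> z'" "z' \<in> {0..T}" using z periodic_of_int[of \<gamma>, OF \<gamma>_periodic] by auto
    then show "x \<in> \<gamma> ` Z" using x0 by (auto simp: Z_def f_def)
  qed
  moreover have "infinite (closed_segment (\<gamma> s) (\<gamma> t))" using assms by (simp add: finite_closed_segment)
  ultimately have "infinite Z" using finite_surj by blast
  then obtain z where z: "z islimpt Z"
    using Heine_Borel_imp_Bolzano_Weierstrass[OF compact_Icc, of Z 0 T] unfolding Z_def by blast
  have "closed {z. f z = 0}" using f_cont by (intro closed_Collect_eq) auto
  then have fz: "f z = 0"
    using z islimpt_subset[of z Z "{z. f z = 0}"] by (auto simp: Z_def closed_limpt)
  define D where "D y = bracket (g 1 s) (g 1 y)" for y
  have D: "(D has_real_derivative bracket (g 1 s) (g 2 z)) (at z)" "D z = 0"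
    using tangent_height_deriv(2) crit(1)[OF fz] by (auto simp: D_def[abs_def])
  \<comment> \<open>\<open>D\<close>, the derivative of \<open>f\<close>, has a simple zero at
    \<open>z\<close>, hence no other zero nearby; Rolle's theorem supplies one between
    \<open>z\<close> and a close zero of \<open>f\<close>.\<close>
  have "\<exists>d>0. \<forall>h>0. h < d \<longrightarrow> D (z + h) \<noteq> 0" "\<exists>d>0. \<forall>h>0. h < d \<longrightarrow> D (z - h) \<noteq> 0"
    using crit(2)[OF fz] DERIV_pos_inc_right[OF D(1)] DERIV_neg_dec_right[OF D(1)]
      DERIV_pos_inc_left[OF D(1)] DERIV_neg_dec_left[OF D(1)] D(2)
    by (metis less_irrefl linorder_neqE_linordered_idom)+
  then obtain d1 d2 where d: "0 < d1" "\<And>h. 0 < h \<Longrightarrow> h < d1 \<Longrightarrow> D (z + h) \<noteq> 0"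
      "0 < d2" "\<And>h. 0 < h \<Longrightarrow> h < d2 \<Longrightarrow> D (z - h) \<noteq> 0" by blast
  obtain z' where z': "z' \<in> Z" "z' \<noteq> z" "dist z' z < min d1 d2"
    using z d unfolding islimpt_approachable by (metis min_less_iff_conj)
  then have "f z' = 0" by (simp add: Z_def)
  obtain \<xi> where \<xi>: "\<xi> \<in> open_segment z z'" "D \<xi> = 0"
  proof (cases "z < z'")
    case True
    then obtain \<xi> where "z < \<xi>" "\<xi> < z'" "f z' - f z = (z' - z) * D \<xi>"
      unfolding D_def using MVT2[OF _ f_deriv1] by blast
    then show ?thesis using that[of \<xi>] True fz \<open>f z' = 0\<close> by (auto simp: open_segment_eq_real_ivl)
  next
    case False
    then have "z' < z" using z'(2) by simp
    then obtain \<xi> where "z' < \<xi>" "\<xi> < z" "f z - f z' = (z - z') * D \<xi>"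
      unfolding D_def using MVT2[OF _ f_deriv1] by blast
    then show ?thesis using that[of \<xi>] False fz \<open>f z' = 0\<close> by (auto simp: open_segment_eq_real_ivl)
  qed
  then show False
    using d(2)[of "\<xi> - z"] d(4)[of "z - \<xi>"] z'(3)
    by (auto simp: open_segment_eq_real_ivl dist_real_def split: if_splits)
qed

end

section \<open>Reparametrization by affine arc length\<close>

context convex_curve
begin

text \<open>\<open>K1\<close> and \<open>K2\<close> are the first two derivatives of
  \<open>K\<close>; the term [\<gamma>'', \<gamma>''] has dropped out of \<open>K1\<close>.\<close>

definition K :: "real \<Rightarrow> real" where "K t = bracket (g 1 t) (g 2 t)"
definition K1 :: "real \<Rightarrow> real" where "K1 t = bracket (g 1 t) (g 3 t)"
definition K2 :: "real \<Rightarrow> real" where "K2 t = bracket (g 2 t) (g 3 t) + bracket (g 1 t) (g 4 t)"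

text \<open>\<open>\<tau>\<close> is the derivative of the curve with respect to affine arc length, and \<open>\<rho>\<close> the density of
  affine arc length; both are functions of the given parameter.\<close>

definition \<rho> :: "real \<Rightarrow> real" where "\<rho> t = root 3 (K t)"
text \<open>The reciprocal of \<rho>, written as a real power so that the power rule applies. A
  suffix 1 or 2 marks derivatives in the given parameter, not in arc length.\<close>

definition \<alpha> :: "real \<Rightarrow> real" where "\<alpha> t = K t powr (-1/3)"
definition \<alpha>1 :: "real \<Rightarrow> real" where "\<alpha>1 t = -1/3 * K t powr (-4/3) * K1 t"
definition \<alpha>2 :: "real \<Rightarrow> real" where
  "\<alpha>2 t = 4/9 * K t powr (-7/3) * (K1 t)\<^sup>2 - 1/3 * K t powr (-4/3) * K2 t"
definition \<tau> :: "real \<Rightarrow> real^2" where "\<tau> t = \<alpha> t *\<^sub>R g 1 t"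
definition \<tau>1 :: "real \<Rightarrow> real^2" where "\<tau>1 t = \<alpha> t *\<^sub>R g 2 t + \<alpha>1 t *\<^sub>R g 1 t"
definition \<tau>2 :: "real \<Rightarrow> real^2" where
  "\<tau>2 t = \<alpha> t *\<^sub>R g 3 t + (2 * \<alpha>1 t) *\<^sub>R g 2 t + \<alpha>2 t *\<^sub>R g 1 t"

lemma K_pos: "0 < K t"
  unfolding K_def by (rule bracket_pos)

lemma g_deriv_numeral:
  "(g 1 has_vector_derivative g 2 t) (at t)" "(g 2 has_vector_derivative g 3 t) (at t)"
  "(g 3 has_vector_derivative g 4 t) (at t)"
  using g_deriv[of 1] g_deriv[of 2] g_deriv[of 3] by (simp_all add: eval_nat_numeral)

lemma bracket_deriv:
  assumes "(u has_vector_derivative u') (at t)" "(v has_vector_derivative v') (at t)"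
  shows "((\<lambda>t. bracket (u t) (v t)) has_real_derivative bracket (u t) v' + bracket u' (v t)) (at t)"
  using bracket.has_vector_derivative[OF assms]
  by (simp add: has_real_derivative_iff_has_vector_derivative)

lemma K_deriv: "(K has_real_derivative K1 t) (at t)" "(K1 has_real_derivative K2 t) (at t)"
  using bracket_deriv[OF g_deriv_numeral(1,2), of t] bracket_deriv[OF g_deriv_numeral(1,3), of t]
  by (simp_all add: K_def[abs_def] K1_def[abs_def] K2_def add.commute)

lemma \<alpha>_deriv: "(\<alpha> has_real_derivative \<alpha>1 t) (at t)" "(\<alpha>1 has_real_derivative \<alpha>2 t) (at t)"
proof -
  have powr_deriv: "((\<lambda>t. K t powr e) has_real_derivative e * K t powr (e - 1) * K1 t) (at t)" for e
    using DERIV_fun_powr[OF K_deriv(1) K_pos, of e t] by simp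
  show "(\<alpha> has_real_derivative \<alpha>1 t) (at t)"
    using powr_deriv[of "-1/3"] by (simp add: \<alpha>_def[abs_def] \<alpha>1_def)
  have "((\<lambda>t. -1/3 * K t powr (-4/3) * K1 t) has_real_derivative
      (-1/3 * (-4/3 * K t powr (-4/3 - 1) * K1 t)) * K1 t + K2 t * (-1/3 * K t powr (-4/3))) (at t)"
    by (intro DERIV_mult DERIV_cmult powr_deriv K_deriv)
  then show "(\<alpha>1 has_real_derivative \<alpha>2 t) (at t)"
    by (simp add: \<alpha>1_def[abs_def] \<alpha>2_def power2_eq_square algebra_simps)
qed

lemma \<tau>_deriv: "(\<tau> has_vector_derivative \<tau>1 t) (at t)" "(\<tau>1 has_vector_derivative \<tau>2 t) (at t)"
proof -
  show "(\<tau> has_vector_derivative \<tau>1 t) (at t)"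
    unfolding \<tau>_def[abs_def] \<tau>1_def by (intro has_vector_derivative_scaleR \<alpha>_deriv g_deriv_numeral)
  have "(\<tau>1 has_vector_derivative (\<alpha> t *\<^sub>R g 3 t + \<alpha>1 t *\<^sub>R g 2 t) + (\<alpha>1 t *\<^sub>R g 2 t + \<alpha>2 t *\<^sub>R g 1 t)) (at t)"
    unfolding \<tau>1_def[abs_def]
    by (intro has_vector_derivative_add has_vector_derivative_scaleR \<alpha>_deriv g_deriv_numeral)
  moreover have "(\<alpha> t *\<^sub>R g 3 t + \<alpha>1 t *\<^sub>R g 2 t) + (\<alpha>1 t *\<^sub>R g 2 t + \<alpha>2 t *\<^sub>R g 1 t) = \<tau>2 t"
    by (simp add: \<tau>2_def algebra_simps flip: scaleR_2)
  ultimately show "(\<tau>1 has_vector_derivative \<tau>2 t) (at t)" by simp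
qed

lemma \<rho>_pos: "0 < \<rho> t"
  using K_pos by (simp add: \<rho>_def)

lemma \<alpha>_eq: "\<alpha> t = 1 / \<rho> t"
  using K_pos[of t] by (simp add: \<alpha>_def \<rho>_def root_powr_inverse powr_minus_divide)

text \<open>The normalisation of affine arc length: \<tau>1 / \<rho> is the derivative of \<tau>
  with respect to it, so the identity says [\<beta>', \<beta>''] = 1.\<close>

lemma bracket_\<tau>_\<tau>1: "bracket (\<tau> t) (\<tau>1 t) = \<rho> t"
proof -
  have "bracket (\<tau> t) (\<tau>1 t) = \<alpha> t * \<alpha> t * K t"
    by (simp add: \<tau>_def \<tau>1_def K_def bracket.add_right bracket.scaleR_left bracket.scaleR_right)
  also have "K t = \<rho> t ^ 3" using K_pos[of t] by (simp add: \<rho>_def)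
  finally show ?thesis using \<rho>_pos[of t] by (simp add: \<alpha>_eq power3_eq_cube)
qed

lemma \<rho>_deriv: "(\<rho> has_real_derivative bracket (\<tau> t) (\<tau>2 t)) (at t)"
  using bracket_deriv[OF \<tau>_deriv, of t] by (simp add: bracket_\<tau>_\<tau>1)

lemma affine_data_periodic:
  "K (t + T) = K t" "\<rho> (t + T) = \<rho> t" "\<tau> (t + T) = \<tau> t" "\<tau>1 (t + T) = \<tau>1 t" "\<tau>2 (t + T) = \<tau>2 t"
  by (simp_all add: K_def K1_def K2_def \<alpha>_def \<alpha>1_def \<alpha>2_def \<rho>_def \<tau>_def \<tau>1_def \<tau>2_def g_periodic)

lemma affine_data_continuous:
  "continuous_on UNIV \<rho>" "continuous_on UNIV \<tau>" "continuous_on UNIV \<tau>1" "continuous_on UNIV \<tau>2"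
proof -
  have K: "continuous_on UNIV K" "continuous_on UNIV K1" "continuous_on UNIV K2"
    unfolding K_def[abs_def] K1_def[abs_def] K2_def[abs_def]
    by (intro continuous_intros bracket.continuous_on g_cont)+
  have \<alpha>: "continuous_on UNIV \<alpha>" "continuous_on UNIV \<alpha>1" "continuous_on UNIV \<alpha>2"
    unfolding \<alpha>_def[abs_def] \<alpha>1_def[abs_def] \<alpha>2_def[abs_def]
    using K_pos by (intro continuous_intros K; simp add: less_imp_neq[symmetric])+
  show "continuous_on UNIV \<rho>" unfolding \<rho>_def[abs_def] by (intro continuous_intros K)
  show "continuous_on UNIV \<tau>" "continuous_on UNIV \<tau>1" "continuous_on UNIV \<tau>2"
    unfolding \<tau>_def[abs_def] \<tau>1_def[abs_def] \<tau>2_def[abs_def] by (intro continuous_intros \<alpha> g_cont)+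
qed

section \<open>Affine arc length as a parameter\<close>

text \<open>Affine arc length up to a constant, as an antiderivative on the whole line; the integral
  over \<open>{0..t}\<close> would vanish for negative \<open>t\<close>.\<close>

definition \<sigma> :: "real \<Rightarrow> real" where
  "\<sigma> = (SOME \<sigma>. \<forall>t. (\<sigma> has_real_derivative \<rho> t) (at t))"

lemma \<sigma>_deriv: "(\<sigma> has_real_derivative \<rho> t) (at t)"
proof -
  have "\<exists>\<sigma>. \<forall>t. - \<infinity> < ereal t \<longrightarrow> ereal t < \<infinity> \<longrightarrow> (\<sigma> has_vector_derivative \<rho> t) (at t)"
    using affine_data_continuous(1)
    by (intro einterval_antiderivative) (auto simp: continuous_on_eq_continuous_at)
  then have "\<exists>\<sigma>. \<forall>t. (\<sigma> has_real_derivative \<rho> t) (at t)"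
    by (simp add: has_real_derivative_iff_has_vector_derivative)
  then show ?thesis unfolding \<sigma>_def by (rule someI_ex[THEN spec])
qed

lemma \<sigma>_strict_mono: "x < y \<Longrightarrow> \<sigma> x < \<sigma> y"
  using DERIV_pos_imp_increasing[of x y \<sigma>] \<sigma>_deriv \<rho>_pos by blast

lemma affine_arclength_\<sigma>: "a \<le> b \<Longrightarrow> affine_arclength \<gamma> a b = \<sigma> b - \<sigma> a"
proof -
  assume "a \<le> b"
  then have "(\<rho> has_integral \<sigma> b - \<sigma> a) {a..b}"
    using \<sigma>_deriv by (intro fundamental_theorem_of_calculus)
      (auto simp flip: has_real_derivative_iff_has_vector_derivative intro: has_field_derivative_at_within)
  then have "integral {a..b} \<rho> = \<sigma> b - \<sigma> a" by (rule integral_unique)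
  then show ?thesis
    unfolding affine_arclength_def g_1 g_2 by (simp add: \<rho>_def[abs_def] K_def)
qed

definition L :: real where "L = affine_arclength \<gamma> 0 T"

lemma \<sigma>_shift: "\<sigma> (t + T) = \<sigma> t + L"
proof -
  have "((\<lambda>t. \<sigma> (t + T) - \<sigma> t) has_real_derivative 0) (at t)" for t
  proof -
    have "((\<lambda>t. \<sigma> (t + T)) has_real_derivative \<rho> (t + T)) (at t)"
      using DERIV_shift[of \<sigma> "\<rho> (t + T)" t T] \<sigma>_deriv by simp
    from DERIV_diff[OF this \<sigma>_deriv[of t]] show ?thesis by (simp add: affine_data_periodic)
  qed
  then have "\<sigma> (t + T) - \<sigma> t = \<sigma> (0 + T) - \<sigma> 0"
    using DERIV_isconst_all[of "\<lambda>t. \<sigma> (t + T) - \<sigma> t"] by blast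
  then show ?thesis using affine_arclength_\<sigma>[of 0 T] T_pos by (simp add: L_def)
qed

lemma L_pos: "0 < L"
  using \<sigma>_strict_mono[of 0 T] \<sigma>_shift[of 0] T_pos by simp

lemma \<sigma>_shift_int: "\<sigma> (t + of_int j * T) = \<sigma> t + of_int j * L"
proof -
  \<comment> \<open>Subtracting the linear function of slope \<open>L / T\<close> makes \<sigma>
    periodic.\<close>
  have "\<sigma> (t + T) - (t + T) * (L / T) = \<sigma> t - t * (L / T)" for t
  proof -
    have "(t + T) * (L / T) = t * (L / T) + L" using T_pos by (simp add: field_simps)
    then show ?thesis by (simp only: \<sigma>_shift)
  qed
  from periodic_of_int[of "\<lambda>t. \<sigma> t - t * (L / T)" T t j, OF this] have "\<sigma> (t + of_int j * T) - (t + of_int j * T) * (L / T) = \<sigma> t - t * (L / T)" .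
  moreover have "(t + of_int j * T) * (L / T) = t * (L / T) + of_int j * L"
    using T_pos by (simp add: field_simps)
  ultimately show ?thesis by simp
qed

text \<open>The bound serves twice: for the continuity of the inverse \<phi>, and to turn a cubic
  error in the given parameter into one in arc length.\<close>

lemma \<sigma>_inverse_lipschitz:
  obtains B where "0 < B" "\<And>x y. \<bar>y - x\<bar> \<le> B * \<bar>\<sigma> y - \<sigma> x\<bar>"
proof -
  have "continuous_on UNIV (\<lambda>t. 1 / \<rho> t)"
    using \<rho>_pos by (intro continuous_intros affine_data_continuous) (simp add: less_imp_neq[symmetric])
  moreover have "1 / \<rho> (t + T) = 1 / \<rho> t" for t by (simp add: affine_data_periodic)
  ultimately obtain B where B: "0 < B" "\<And>t. norm (1 / \<rho> t) \<le> B"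
    using periodic_continuous_bounded[OF T_pos, of "\<lambda>t. 1 / \<rho> t"] by blast
  have "\<bar>y - x\<bar> \<le> B * \<bar>\<sigma> y - \<sigma> x\<bar>" for x y
  proof -
    obtain \<xi> where \<xi>: "\<sigma> y - \<sigma> x = (y - x) * \<rho> \<xi>"
      using mvt_closed_segment[OF \<sigma>_deriv, of x y] by blast
    have "1 \<le> B * \<rho> \<xi>" using B(2)[of \<xi>] \<rho>_pos[of \<xi>] by (simp add: field_simps)
    then have "\<bar>y - x\<bar> * 1 \<le> \<bar>y - x\<bar> * (B * \<rho> \<xi>)" by (intro mult_left_mono) auto
    then show ?thesis using \<rho>_pos[of \<xi>] by (simp add: \<xi> abs_mult mult_ac)
  qed
  with B(1) show ?thesis by (rule that)
qed

definition \<phi> :: "real \<Rightarrow> real" where "\<phi> = inv \<sigma>"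

lemma \<sigma>_\<phi>: "\<sigma> (\<phi> x) = x"
proof -
  have "\<exists>t. \<sigma> t = x"
  proof -
    \<comment> \<open>Surjectivity of \<sigma>: the intermediate value theorem covers one period,
      integer shifts do the rest.\<close>
    obtain s j where j: "x - \<sigma> 0 = s + of_int j * L" "0 \<le> s" "s < L" by (rule reduce_mod_period[OF L_pos])
    have "\<sigma> 0 \<le> \<sigma> 0 + s" "\<sigma> 0 + s \<le> \<sigma> T" using j \<sigma>_shift[of 0] by auto
    then obtain t where "\<sigma> t = \<sigma> 0 + s"
      using IVT[of \<sigma> 0 "\<sigma> 0 + s" T] T_pos \<sigma>_deriv DERIV_isCont by (meson less_imp_le)
    then have "\<sigma> (t + of_int j * T) = x" using j(1) by (simp add: \<sigma>_shift_int)
    then show ?thesis ..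
  qed
  then show ?thesis unfolding \<phi>_def by (metis f_inv_into_f rangeI)
qed

lemma \<phi>_\<sigma>: "\<phi> (\<sigma> t) = t"
  using \<sigma>_\<phi>[of "\<sigma> t"] \<sigma>_strict_mono by (metis linorder_neqE_linordered_idom less_irrefl)

lemma \<phi>_mono: "x \<le> y \<Longrightarrow> \<phi> x \<le> \<phi> y"
  using \<sigma>_strict_mono[of "\<phi> y" "\<phi> x"] by (force simp: \<sigma>_\<phi>)

lemma \<phi>_cont: "isCont \<phi> x"
proof -
  obtain B where B: "0 < B" "\<And>x y. \<bar>y - x\<bar> \<le> B * \<bar>\<sigma> y - \<sigma> x\<bar>" using \<sigma>_inverse_lipschitz by blast
  have "B-lipschitz_on UNIV \<phi>"
    using B(1) B(2)[of "\<phi> y" "\<phi> x" for x y] by (intro lipschitz_onI) (auto simp: dist_real_def \<sigma>_\<phi>)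
  then show ?thesis
    using lipschitz_on_continuous_on continuous_on_eq_continuous_at open_UNIV by blast
qed

definition \<beta> :: "real \<Rightarrow> real^2" where "\<beta> x = \<gamma> (\<phi> x)"

lemma \<beta>_\<sigma>: "\<beta> (\<sigma> t) = \<gamma> t"
  by (simp add: \<beta>_def \<phi>_\<sigma>)

lemma range_\<beta>: "range \<beta> = range \<gamma>"
  by (metis (mono_tags, opaque_lifting) \<beta>_\<sigma> \<beta>_def image_subset_iff rangeI subset_antisym)

lemma \<beta>_deriv: "(\<beta> has_vector_derivative \<tau> (\<phi> x)) (at x)"
proof -
  have "(\<phi> has_real_derivative inverse (\<rho> (\<phi> x))) (at x)"
    using \<rho>_pos[of "\<phi> x"]
    by (intro DERIV_inverse_function[where a = "x - 1" and b = "x + 1" and f = \<sigma>] \<sigma>_deriv \<phi>_cont) (auto simp: \<sigma>_\<phi>)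
  then have "(\<gamma> \<circ> \<phi> has_vector_derivative inverse (\<rho> (\<phi> x)) *\<^sub>R g 1 (\<phi> x)) (at x)"
    by (intro vector_diff_chain_at \<gamma>_deriv) (simp add: has_real_derivative_iff_has_vector_derivative)
  then show ?thesis by (simp add: \<beta>_def[abs_def] o_def \<tau>_def \<alpha>_eq inverse_eq_divide)
qed

lemma \<gamma>_eq_iff: "\<gamma> s = \<gamma> t \<Longrightarrow> \<exists>j::int. t = s + of_int j * T"
proof -
  assume eq: "\<gamma> s = \<gamma> t"
  obtain s' j where s: "s = s' + of_int j * T" "0 \<le> s'" "s' < T" by (rule reduce_mod_period[OF T_pos])
  obtain t' k where t: "t = t' + of_int k * T" "0 \<le> t'" "t' < T" by (rule reduce_mod_period[OF T_pos])
  have "\<gamma> s' = \<gamma> t'" using eq s t periodic_of_int[of \<gamma>, OF \<gamma>_periodic] by simp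
  then have "s' = t'" using \<gamma>_inj s t by (auto dest: inj_onD)
  then have "t = s + of_int (k - j) * T" using s(1) t(1) by (simp add: algebra_simps)
  then show ?thesis ..
qed

text \<open>The second derivative in \<open>y\<close> of the left-hand side is \<open>[\<tau> x - \<tau> y, \<tau>2 y]\<close>, because
  \<open>[\<tau>, \<tau>1] = \<rho>\<close> gives \<open>[\<tau>, \<tau>2] = \<rho>'\<close>.\<close>

lemma bracket_\<tau>_approx:
  obtains M where "0 \<le> M" "\<And>x y. \<bar>bracket (\<tau> x) (\<tau> y) - (\<sigma> y - \<sigma> x)\<bar> \<le> M * \<bar>y - x\<bar> ^ 3"
proof -
  obtain B1 where B1: "0 < B1" "\<And>t. norm (\<tau>1 t) \<le> B1"
    using periodic_continuous_bounded[OF T_pos affine_data_periodic(4) affine_data_continuous(3)] by blast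
  obtain B2 where B2: "0 < B2" "\<And>t. norm (\<tau>2 t) \<le> B2"
    using periodic_continuous_bounded[OF T_pos affine_data_periodic(5) affine_data_continuous(4)] by blast
  obtain Kb where Kb: "0 < Kb" "\<And>u v. norm (bracket u v) \<le> norm u * norm v * Kb"
    using bracket.pos_bounded by blast
  define M where "M = B1 * B2 * Kb"
  have M: "0 \<le> M" using B1 B2 Kb by (simp add: M_def)
  have M_bound: "\<bar>bracket (\<tau>1 x) (\<tau>2 y)\<bar> \<le> M" for x y
  proof -
    have "norm (\<tau>1 x) * norm (\<tau>2 y) * Kb \<le> B1 * B2 * Kb"
      using B1 B2 Kb by (intro mult_right_mono mult_mono) auto
    then show ?thesis using Kb(2)[of "\<tau>1 x" "\<tau>2 y"] by (simp add: M_def)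
  qed
  have "\<bar>bracket (\<tau> x) (\<tau> y) - (\<sigma> y - \<sigma> x)\<bar> \<le> M * \<bar>y - x\<bar> ^ 3" for x y
  proof -
    have d1: "((\<lambda>y. bracket (\<tau> x) (\<tau> y) - (\<sigma> y - \<sigma> x)) has_real_derivative bracket (\<tau> x) (\<tau>1 y) - \<rho> y) (at y)" for y
      by (auto intro!: derivative_eq_intros bracket_has_real_derivative_right \<tau>_deriv \<sigma>_deriv)
    obtain \<eta> where \<eta>: "\<eta> \<in> closed_segment x y"
      "bracket (\<tau> x) (\<tau> y) - (\<sigma> y - \<sigma> x) - (bracket (\<tau> x) (\<tau> x) - (\<sigma> x - \<sigma> x)) = (y - x) * (bracket (\<tau> x) (\<tau>1 \<eta>) - \<rho> \<eta>)"
      by (rule mvt_closed_segment[OF d1])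
    have d2: "((\<lambda>y. bracket (\<tau> x) (\<tau>1 y) - \<rho> y) has_real_derivative bracket (\<tau> x) (\<tau>2 y) - bracket (\<tau> y) (\<tau>2 y)) (at y)" for y
      by (auto intro!: derivative_eq_intros bracket_has_real_derivative_right \<tau>_deriv \<rho>_deriv)
    obtain \<zeta> where \<zeta>: "\<zeta> \<in> closed_segment x \<eta>"
      "bracket (\<tau> x) (\<tau>1 \<eta>) - \<rho> \<eta> - (bracket (\<tau> x) (\<tau>1 x) - \<rho> x) = (\<eta> - x) * (bracket (\<tau> x) (\<tau>2 \<zeta>) - bracket (\<tau> \<zeta>) (\<tau>2 \<zeta>))"
      by (rule mvt_closed_segment[OF d2])
    \<comment> \<open>The difference of the two determinants vanishes at \<zeta> = x; one more mean
      value supplies the third factor of the cubic bound.\<close>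
    have d3: "((\<lambda>t. bracket (\<tau> t) (\<tau>2 \<zeta>)) has_real_derivative bracket (\<tau>1 t) (\<tau>2 \<zeta>)) (at t)" for t
      by (rule bracket_has_real_derivative_left[OF \<tau>_deriv(1)])
    obtain \<omega> where \<omega>: "bracket (\<tau> x) (\<tau>2 \<zeta>) - bracket (\<tau> \<zeta>) (\<tau>2 \<zeta>) = (x - \<zeta>) * bracket (\<tau>1 \<omega>) (\<tau>2 \<zeta>)"
      using mvt_closed_segment[OF d3, of \<zeta> x] by blast
    have le: "\<bar>\<eta> - x\<bar> \<le> \<bar>y - x\<bar>" "\<bar>x - \<zeta>\<bar> \<le> \<bar>y - x\<bar>"
      using \<eta>(1) \<zeta>(1) by (auto simp: closed_segment_eq_real_ivl split: if_splits)
    have "bracket (\<tau> x) (\<tau> y) - (\<sigma> y - \<sigma> x) = (y - x) * ((\<eta> - x) * ((x - \<zeta>) * bracket (\<tau>1 \<omega>) (\<tau>2 \<zeta>)))"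
      using \<eta>(2) \<zeta>(2) \<omega> by (simp add: bracket_\<tau>_\<tau>1)
    also have "\<bar>\<dots>\<bar> \<le> \<bar>y - x\<bar> * (\<bar>y - x\<bar> * (\<bar>y - x\<bar> * M))"
      unfolding abs_mult using le M M_bound by (intro mult_mono mult_nonneg_nonneg) auto
    finally show ?thesis by (simp add: power3_eq_cube mult_ac)
  qed
  with M show ?thesis by (rule that)
qed

lemma affine_curve_\<beta>: obtains C where "affine_curve \<beta> (\<lambda>x. \<tau> (\<phi> x)) L C"
proof -
  obtain M where M: "0 \<le> M" "\<And>x y. \<bar>bracket (\<tau> x) (\<tau> y) - (\<sigma> y - \<sigma> x)\<bar> \<le> M * \<bar>y - x\<bar> ^ 3"
    using bracket_\<tau>_approx by blast
  obtain B where B: "0 < B" "\<And>x y. \<bar>y - x\<bar> \<le> B * \<bar>\<sigma> y - \<sigma> x\<bar>" using \<sigma>_inverse_lipschitz by blast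
  have \<phi>_shift: "\<phi> (x + L) = \<phi> x + T" for x
    using \<phi>_\<sigma>[of "\<phi> x + T"] by (simp add: \<sigma>_shift \<sigma>_\<phi>)
  have "affine_curve \<beta> (\<lambda>x. \<tau> (\<phi> x)) L (M * B ^ 3)"
  proof
    show "0 < L" by (rule L_pos)
    fix x y
    show "\<beta> (x + L) = \<beta> x" by (simp add: \<beta>_def \<phi>_shift \<gamma>_periodic)
    show "(\<beta> has_vector_derivative \<tau> (\<phi> x)) (at x)" by (rule \<beta>_deriv)
    show "\<exists>j::int. y = x + of_int j * L" if eq: "\<beta> x = \<beta> y"
    proof -
      obtain j :: int where "\<phi> y = \<phi> x + of_int j * T" using eq \<gamma>_eq_iff unfolding \<beta>_def by blast
      then have "\<sigma> (\<phi> y) = \<sigma> (\<phi> x) + of_int j * L" by (simp add: \<sigma>_shift_int)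
      then show ?thesis by (auto simp: \<sigma>_\<phi>)
    qed
    show "\<bar>bracket (\<tau> (\<phi> x)) (\<tau> (\<phi> y)) - (y - x)\<bar> \<le> M * B ^ 3 * \<bar>y - x\<bar> ^ 3"
    proof -
      have "\<bar>\<phi> y - \<phi> x\<bar> ^ 3 \<le> (B * \<bar>y - x\<bar>) ^ 3"
        using B(2)[of "\<phi> y" "\<phi> x"] by (intro power_mono) (auto simp: \<sigma>_\<phi>)
      then have "M * \<bar>\<phi> y - \<phi> x\<bar> ^ 3 \<le> M * (B * \<bar>y - x\<bar>) ^ 3" using M(1) by (rule mult_left_mono)
      then show ?thesis using M(2)[of "\<phi> x" "\<phi> y"] by (simp add: \<sigma>_\<phi> power_mult_distrib mult_ac)
    qed
    show "0 < bracket (\<tau> (\<phi> x)) (\<beta> y - \<beta> x)" if "\<beta> x \<noteq> \<beta> y"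
      using support_strict[of "\<phi> y" "\<phi> x"] that \<rho>_pos by (auto simp: \<tau>_def \<alpha>_eq \<beta>_def bracket.scaleR_left)
  next
    have "isCont \<tau> y" for y using affine_data_continuous(2) by (simp add: continuous_on_eq_continuous_at)
    then have "isCont (\<lambda>x. \<tau> (\<phi> x)) x" for x by (intro isCont_o2[OF \<phi>_cont])
    then show "continuous_on UNIV (\<lambda>x. \<tau> (\<phi> x))" by (simp add: continuous_on_eq_continuous_at)
  qed
  then show ?thesis by (rule that)
qed

lemma \<beta>_periodic_int: "\<beta> (x + of_int j * L) = \<beta> x"
  and \<beta>_eqD: "\<beta> x = \<beta> y \<Longrightarrow> \<exists>j::int. y = x + of_int j * L"
proof -
  obtain C where "affine_curve \<beta> (\<lambda>x. \<tau> (\<phi> x)) L C" by (rule affine_curve_\<beta>)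
  then interpret affine_curve \<beta> "\<lambda>x. \<tau> (\<phi> x)" L C .
  show "\<beta> (x + of_int j * L) = \<beta> x" by (rule periodic_of_int[of \<beta>, OF periodic])
  show "\<beta> x = \<beta> y \<Longrightarrow> \<exists>j::int. y = x + of_int j * L" by (rule injective)
qed

section \<open>Affine distances in the arc length parameter, and the initial points\<close>

text \<open>Any positive arc between the two points has a length \<open>r\<close> plus an integer
  multiple of \<open>L\<close>; since \<open>r < L\<close> and lengths are nonnegative, the integer
  is not negative and \<open>r\<close> is the minimum.\<close>

lemma pos_affine_dist_\<beta>:
  assumes "0 \<le> r" "r < L"
  shows "pos_affine_dist \<gamma> (\<beta> x) (\<beta> (x + r)) = r"
  unfolding pos_affine_dist_def
proof (rule cInf_eq_minimum)
  have "affine_arclength \<gamma> (\<phi> x) (\<phi> (x + r)) = r" "\<phi> x \<le> \<phi> (x + r)"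
    using assms by (simp_all add: \<phi>_mono affine_arclength_\<sigma> \<sigma>_\<phi>)
  then show "r \<in> {affine_arclength \<gamma> a b |a b. a \<le> b \<and> \<gamma> a = \<beta> x \<and> \<gamma> b = \<beta> (x + r)}"
    unfolding \<beta>_def by (intro CollectI exI[of _ "\<phi> x"] exI[of _ "\<phi> (x + r)"]) simp
next
  fix z assume "z \<in> {affine_arclength \<gamma> a b |a b. a \<le> b \<and> \<gamma> a = \<beta> x \<and> \<gamma> b = \<beta> (x + r)}"
  then obtain a b where ab: "z = affine_arclength \<gamma> a b" "a \<le> b" "\<gamma> a = \<beta> x" "\<gamma> b = \<beta> (x + r)" by blast
  have z: "z = \<sigma> b - \<sigma> a" using ab by (simp add: affine_arclength_\<sigma>)
  have "\<beta> x = \<beta> (\<sigma> a)" "\<beta> (x + r) = \<beta> (\<sigma> b)" using ab by (simp_all add: \<beta>_\<sigma>)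
  then obtain i j :: int where ij: "\<sigma> a = x + of_int i * L" "\<sigma> b = x + r + of_int j * L"
    using \<beta>_eqD by meson
  have "0 \<le> z" using z ab(2) \<sigma>_strict_mono[of a b] by (cases "a = b") auto
  then have "0 < (of_int (j - i) + 1) * L" using assms by (simp add: z ij algebra_simps)
  then have "0 \<le> j - i" using L_pos by (auto simp: zero_less_mult_iff)
  then have "0 \<le> of_int (j - i) * L" using L_pos by simp
  then show "r \<le> z" by (simp add: z ij algebra_simps)
qed

text \<open>Reduction modulo \<open>L\<close> only shortens the arc, so a bound on the drift of the
  parameters bounds the affine distance.\<close>

lemma affine_dist_\<beta>_bounds: "0 \<le> affine_dist \<gamma> (\<beta> x) (\<beta> y)" "affine_dist \<gamma> (\<beta> x) (\<beta> y) \<le> \<bar>y - x\<bar>"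
proof -
  have pos: "0 \<le> pos_affine_dist \<gamma> (\<beta> x) (\<beta> y) \<and> (x \<le> y \<longrightarrow> pos_affine_dist \<gamma> (\<beta> x) (\<beta> y) \<le> y - x)" for x y
  proof -
    obtain r j where r: "y - x = r + of_int j * L" "0 \<le> r" "r < L" by (rule reduce_mod_period[OF L_pos])
    have "\<beta> y = \<beta> ((x + r) + of_int j * L)" using r(1) by (simp add: algebra_simps)
    then have d: "pos_affine_dist \<gamma> (\<beta> x) (\<beta> y) = r" using pos_affine_dist_\<beta>[OF r(2,3)] by (simp only: \<beta>_periodic_int)
    have "r \<le> y - x" if "x \<le> y"
    proof -
      have "0 < (of_int j + 1) * L" using r that by (simp add: algebra_simps)
      then have "0 \<le> j" using L_pos by (auto simp: zero_less_mult_iff)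
      then have "0 \<le> of_int j * L" using L_pos by simp
      then show ?thesis using r(1) by simp
    qed
    with d r show ?thesis by simp
  qed
  show "0 \<le> affine_dist \<gamma> (\<beta> x) (\<beta> y)" using pos by (simp add: affine_dist_def)
  show "affine_dist \<gamma> (\<beta> x) (\<beta> y) \<le> \<bar>y - x\<bar>"
    using pos[of x y] pos[of y x] by (auto simp: affine_dist_def min_def)
qed

text \<open>The distance does not see the direction, hence the two candidates: one arc has length
  \<open>r\<close>, the complementary one \<open>L - r\<close>.\<close>

lemma affine_dist_eqD:
  assumes d: "affine_dist \<gamma> (\<beta> x) q = h" and h: "0 < h" "h < L" and q: "q \<in> range \<gamma>"
  shows "q = \<beta> (x + h) \<or> q = \<beta> (x - h)"
proof -
  obtain y where y: "q = \<beta> y" using q range_\<beta> by auto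
  obtain r j where r: "y - x = r + of_int j * L" "0 \<le> r" "r < L" by (rule reduce_mod_period[OF L_pos])
  have "\<beta> y = \<beta> ((x + r) + of_int j * L)" using r(1) by (simp add: algebra_simps)
  then have q: "q = \<beta> (x + r)" unfolding y by (simp only: \<beta>_periodic_int)
  have "r \<noteq> 0"
    using d h(1) q affine_dist_\<beta>_bounds(2)[of x "x + r"] by auto
  then have "pos_affine_dist \<gamma> (\<beta> (x + r)) (\<beta> ((x + r) + (L - r))) = L - r"
    using r by (intro pos_affine_dist_\<beta>) auto
  moreover have L1: "\<beta> (z + L) = \<beta> z" for z using \<beta>_periodic_int[of z 1] by simp
  ultimately have "pos_affine_dist \<gamma> (\<beta> (x + r)) (\<beta> x) = L - r" by simp
  then have "h = min r (L - r)" using d pos_affine_dist_\<beta>[OF r(2,3), of x] by (simp add: affine_dist_def q)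
  moreover have "\<beta> (x + r) = \<beta> (x - (L - r))" using L1[of "x - (L - r)"] by (simp add: algebra_simps)
  ultimately show ?thesis using q by (auto simp: min_def split: if_splits)
qed

text \<open>The distances alone allow each point on either side of its predecessor. Orientation
  excludes the rest: returning to P_1 makes the determinant zero, and going backwards twice makes it
  negative as soon as the arc of length 2 h is short.\<close>

lemma eventually_sample_points:
  assumes P23: "\<And>n. 3 \<le> n \<Longrightarrow> P2 n \<in> range \<gamma> \<and> P3 n \<in> range \<gamma>"
    and dist: "\<And>n. 3 \<le> n \<Longrightarrow>
        affine_dist \<gamma> (\<beta> x0) (P2 n) = L / real n \<and> affine_dist \<gamma> (P2 n) (P3 n) = L / real n"
    and orient: "\<And>n. 3 \<le> n \<Longrightarrow> 0 < bracket (P2 n - \<beta> x0) (P3 n - \<beta> x0)"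
  shows "\<forall>\<^sub>F n in sequentially. P2 n = \<beta> (x0 + L / n) \<and> P3 n = \<beta> (x0 + 2 * (L / n))"
proof -
  obtain C where "affine_curve \<beta> (\<lambda>x. \<tau> (\<phi> x)) L C" by (rule affine_curve_\<beta>)
  then interpret ac: affine_curve \<beta> "\<lambda>x. \<tau> (\<phi> x)" L C .
  obtain \<delta> where \<delta>: "0 < \<delta>"
    "\<And>a b c d. a < b \<Longrightarrow> b \<le> c \<Longrightarrow> c < d \<Longrightarrow> d < a + \<delta> \<Longrightarrow> 0 < bracket (\<beta> b - \<beta> a) (\<beta> d - \<beta> c)"
    using ac.bracket_chords_pos by blast
  have "\<forall>\<^sub>F n in sequentially. L / real n < \<delta> / 2"
    using lim_const_over_n by (rule order_tendstoD(2)) (use \<delta> in simp)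
  then show ?thesis using eventually_ge_at_top[of 3]
  proof eventually_elim
    case (elim n)
    define h where "h = L / real n"
    have h: "0 < h" "h < L" "2 * h < \<delta>" using elim L_pos by (simp_all add: h_def divide_less_eq)
    have 2: "P2 n = \<beta> (x0 + h) \<or> P2 n = \<beta> (x0 - h)"
      using dist[OF elim(2)] P23[OF elim(2)] h by (intro affine_dist_eqD) (auto simp: h_def)
    have 3: "P3 n = \<beta> (x + h) \<or> P3 n = \<beta> (x - h)" if "P2 n = \<beta> x" for x
      using dist[OF elim(2)] P23[OF elim(2)] h that by (intro affine_dist_eqD) (auto simp: h_def)
    have ne: "P3 n \<noteq> \<beta> x0" using orient[OF elim(2)] by auto
    have "P2 n \<noteq> \<beta> (x0 - h)"
    proof
      assume P2: "P2 n = \<beta> (x0 - h)"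
      then have P3: "P3 n = \<beta> (x0 - 2 * h)" using 3[OF P2] ne by (simp add: algebra_simps)
      have "0 < bracket (\<beta> (x0 - h) - \<beta> (x0 - 2 * h)) (\<beta> x0 - \<beta> (x0 - h))"
        using h by (intro \<delta>(2)) auto
      also have "\<dots> = - bracket (P2 n - \<beta> x0) (P3 n - \<beta> x0)"
        unfolding P2 P3 by (simp add: bracket_eq algebra_simps)
      finally show False using orient[OF elim(2)] by simp
    qed
    then have P2: "P2 n = \<beta> (x0 + h)" using 2 by simp
    moreover have "P3 n = \<beta> (x0 + 2 * h)" using 3[OF P2] ne by (simp add: algebra_simps)
    ultimately show ?case by (simp add: h_def)
  qed
qed

lemma pos_affine_dist_eqD:
  assumes "pos_affine_dist \<gamma> (\<beta> x) q = r" "q \<in> range \<gamma>"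
  shows "q = \<beta> (x + r)"
proof -
  obtain y where y: "q = \<beta> y" using assms(2) range_\<beta> by auto
  obtain s j where s: "y - x = s + of_int j * L" "0 \<le> s" "s < L" by (rule reduce_mod_period[OF L_pos])
  have "\<beta> y = \<beta> ((x + s) + of_int j * L)" using s(1) by (simp add: algebra_simps)
  then have "q = \<beta> (x + s)" unfolding y by (simp only: \<beta>_periodic_int)
  then show ?thesis using assms(1) pos_affine_dist_\<beta>[OF s(2,3)] by simp
qed

end

theorem corollary3p5:
  fixes \<gamma> :: "real \<Rightarrow> real^2" and T L :: real
    and P1 :: "real^2" and P2 P3 :: "nat \<Rightarrow> real^2"
    and P Pbar :: "nat \<Rightarrow> nat \<Rightarrow> real^2" and m :: "nat \<Rightarrow> nat"
  assumes curve: "smooth_closed_convex_curve \<gamma> T"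
    and L: "L = affine_arclength \<gamma> 0 T"
    and P1: "P1 \<in> range \<gamma>"
    and P23: "\<And>n. 3 \<le> n \<Longrightarrow> P2 n \<in> range \<gamma> \<and> P3 n \<in> range \<gamma>"
    and dist: "\<And>n. 3 \<le> n \<Longrightarrow>
        affine_dist \<gamma> P1 (P2 n) = L / real n \<and> affine_dist \<gamma> (P2 n) (P3 n) = L / real n"
    and orient: "\<And>n. 3 \<le> n \<Longrightarrow> 0 < bracket (P2 n - P1) (P3 n - P1)"
    and P: "\<And>n. P n = trapezoidal (range \<gamma>) P1 (P2 n) (P3 n)"
    and m: "\<And>n. m n = stopping_index (P n)"
    and Pbar: "\<And>n i. 3 \<le> n \<Longrightarrow> 1 \<le> i \<Longrightarrow> i \<le> n \<Longrightarrow>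
        Pbar n i \<in> range \<gamma> \<and> pos_affine_dist \<gamma> P1 (Pbar n i) = (real i - 1) * (L / real n)"
  shows "(\<lambda>n. real (m n) / real n) \<longlonglongrightarrow> 1 \<and>
    (\<forall>i :: nat \<Rightarrow> nat. (\<forall>\<^sub>F n in sequentially. 1 \<le> i n \<and> i n \<le> min (m n) n) \<longrightarrow>
       (\<lambda>n. affine_dist \<gamma> (P n (i n)) (Pbar n (i n))) \<longlonglongrightarrow> 0)"
proof -
  interpret cc: convex_curve \<gamma> T by (rule convex_curve.intro[OF curve])
  have L_eq: "L = cc.L" by (simp add: L cc.L_def)
  obtain C where "affine_curve cc.\<beta> (\<lambda>x. cc.\<tau> (cc.\<phi> x)) L C" unfolding L_eq by (rule cc.affine_curve_\<beta>)
  then interpret ac: affine_curve cc.\<beta> "\<lambda>x. cc.\<tau> (cc.\<phi> x)" L C .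
  obtain x0 where x0: "P1 = cc.\<beta> x0" using P1 cc.range_\<beta> by auto
  have sample: "\<forall>\<^sub>F n in sequentially. P2 n = cc.\<beta> (x0 + L / n) \<and> P3 n = cc.\<beta> (x0 + 2 * (L / n))"
    using P23 dist orient unfolding x0 L_eq by (rule cc.eventually_sample_points)
  obtain E p where E: "0 \<le> E" and orbit: "\<forall>\<^sub>F n in sequentially. 4 \<le> n \<and> p n 1 = x0 \<and> p n 2 = x0 + L / n \<and> p n 3 = x0 + 2 * (L / n) \<and>
      (\<forall>j. 1 \<le> j \<and> j \<le> 2 * n \<longrightarrow>
        trapezoidal (range cc.\<beta>) (cc.\<beta> x0) (cc.\<beta> (x0 + L / n)) (cc.\<beta> (x0 + 2 * (L / n))) j = cc.\<beta> (p n j)) \<and>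
      (\<forall>j. 1 \<le> j \<and> j < 2 * n \<longrightarrow> \<bar>p n (Suc j) - p n j - L / n\<bar> \<le> E / (real n)\<^sup>2) \<and>
      (\<forall>j. 1 \<le> j \<and> j \<le> 2 * n \<longrightarrow> \<bar>p n j - x0 - (real j - 1) * (L / n)\<bar> \<le> E / n)"
    by (rule ac.orbit_asymptotics)
  obtain N0 where N0: "\<And>n. N0 \<le> n \<Longrightarrow> P2 n = cc.\<beta> (x0 + L / n) \<and> P3 n = cc.\<beta> (x0 + 2 * (L / n))"
    "\<And>n. N0 \<le> n \<Longrightarrow> 4 \<le> n \<and> p n 1 = x0 \<and> p n 2 = x0 + L / n \<and> p n 3 = x0 + 2 * (L / n) \<and>
      (\<forall>j. 1 \<le> j \<and> j \<le> 2 * n \<longrightarrow>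
        trapezoidal (range cc.\<beta>) (cc.\<beta> x0) (cc.\<beta> (x0 + L / n)) (cc.\<beta> (x0 + 2 * (L / n))) j = cc.\<beta> (p n j)) \<and>
      (\<forall>j. 1 \<le> j \<and> j < 2 * n \<longrightarrow> \<bar>p n (Suc j) - p n j - L / n\<bar> \<le> E / (real n)\<^sup>2) \<and>
      (\<forall>j. 1 \<le> j \<and> j \<le> 2 * n \<longrightarrow> \<bar>p n j - x0 - (real j - 1) * (L / n)\<bar> \<le> E / n)"
    using eventually_conj[OF sample orbit] unfolding eventually_sequentially by blast
  interpret orb: trapezoidal_orbit cc.\<beta> "\<lambda>x. cc.\<tau> (cc.\<phi> x)" L C x0 E p P N0
  proof
    show "4 \<le> N0" using N0(2)[of N0] by simp
    show "P n j = cc.\<beta> (p n j)" if "N0 \<le> n" "1 \<le> j" "j \<le> 2 * n" for n j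
      using N0[OF that(1)] that(2,3) by (simp add: P x0 cc.range_\<beta>)
  qed (use E N0(2) in blast)+
  show ?thesis
  proof (intro conjI allI impI)
    show "(\<lambda>n. real (m n) / real n) \<longlonglongrightarrow> 1"
      unfolding m by (rule orb.stopping_index_asymptotics)
  next
    fix i :: "nat \<Rightarrow> nat"
    assume i: "\<forall>\<^sub>F n in sequentially. 1 \<le> i n \<and> i n \<le> min (m n) n"
    show "(\<lambda>n. affine_dist \<gamma> (P n (i n)) (Pbar n (i n))) \<longlonglongrightarrow> 0"
    proof (rule Lim_null_comparison)
      \<comment> \<open>The drift bound is uniform in the index, so \<open>i\<close> may depend on
        \<open>n\<close> in any way.\<close>
      show "(\<lambda>n. E / real n) \<longlonglongrightarrow> 0" by (rule lim_const_over_n)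
      show "\<forall>\<^sub>F n in sequentially. norm (affine_dist \<gamma> (P n (i n)) (Pbar n (i n))) \<le> E / real n"
        using i eventually_ge_at_top[of N0]
      proof eventually_elim
        case (elim n)
        then have *: "3 \<le> n" "1 \<le> i n" "i n \<le> n" "i n \<le> 2 * n" using orb.N by auto
        have "Pbar n (i n) = cc.\<beta> (x0 + (real (i n) - 1) * (L / n))"
          using Pbar[OF *(1-3)] unfolding x0 by (intro cc.pos_affine_dist_eqD) auto
        moreover have "P n (i n) = cc.\<beta> (p n (i n))" using elim(2) * by (intro orb.P_eq)
        moreover have "\<bar>p n (i n) - x0 - (real (i n) - 1) * (L / n)\<bar> \<le> E / n"
          using elim(2) * by (intro orb.drift)
        moreover have "\<bar>x0 + (real (i n) - 1) * (L / n) - p n (i n)\<bar> = \<bar>p n (i n) - x0 - (real (i n) - 1) * (L / n)\<bar>"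
          by (simp add: abs_minus_commute algebra_simps)
        ultimately show ?case
          using cc.affine_dist_\<beta>_bounds[of "p n (i n)" "x0 + (real (i n) - 1) * (L / n)"] by simp
      qed
    qed
  qed
qed

end
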